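(* (Integral 3, difference equation.) Let $n\ge1$ and let $p,q\ge0$ be integers. (i) For fixed partitions $\lambda,\mu$ with at most $n$ rows, the integral $$a_{\lambda\mu}(z)=\int_{U(n)}\mathbf s_\lambda(M)\mathbf s_\mu(\bar M)\det(I+zM)^p\det(I+z\bar M)^q\,dM=\sum_{k\ge0}b^{(k)}_{xy}z^k$$ satisfies the difference equation $$\sum_{i=1}^n\Big((\lambda_i-i+n)a_{\lambda-e_i,\mu}+(\lambda_i-i+n+p+1)a_{\lambda+e_i,\mu}\Big)-\sum_{i=1}^n\Big((\mu_i-i+n)a_{\lambda,\mu-e_i}+(\mu_i-i+n+q+1)a_{\lambda,\mu+e_i}\Big)+(z+z^{-1})(|\lambda|-|\mu|)a_{\lambda\mu}=0.$$ (ii) The coefficients $b^{(k)}_{xy}$, where $x=(x_1<\dots<x_n)$ and $y=(y_1<\dots<y_n)$ are given by $x_i=\lambda_{n-i+1}+i-1$, $y_i=\mu_{n-i+1}+i-1$, satisfy $$\sum_{i=1}^n\Big(x_ib^{(k)}_{x-e_i,y}+(x_i+p+1)b^{(k)}_{x+e_i,y}-y_ib^{(k)}_{x,y-e_i}-(y_i+q+1)b^{(k)}_{x,y+e_i}\Big)+\sum_{i=1}^n(x_i-y_i)\Big(b^{(k-1)}_{xy}+b^{(k+1)}_{xy}\Big)=0.$$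
   Context: $dM$ is normalized Haar measure on the unitary group $U(n)$, $\bar M$ the complex conjugate of $M$; $\mathbf s_\lambda(M)$ is the Schur function of $\lambda$ evaluated at the eigenvalues of $M$. $e_i$ is the $i$-th unit vector, $|\lambda|=\sum_i\lambda_i$. Conventions: $a_{\lambda\mu}=0$ if $\lambda$ or $\mu$ is not a partition; $b^{(k)}_{xy}=0$ if the strict inequalities $x_1<\dots<x_n$ and $y_1<\dots<y_n$ are not satisfied, and $b^{(k)}_{xy}=0$ for $k<0$.
   Formalization: The printed equations fail for p≠q (n=1, p=1, q=0, λ=μ=∅ gives −z in (i)); the formal version adds n(p−q)z·a_{λμ} to the left side of (i) and n(p−q)b^{(k−1)}_{xy} to that of (ii), which vanish when p=q; (i) is stated for all complex z≠0. *)

theory Defs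
  imports
    "HOL-Complex_Analysis.Complex_Analysis"
    "Jordan_Normal_Form.Determinant"
begin

hide_const (open) Matrix.mat Matrix.transpose_mat Determinant.det

(* The group U(n), with n = CARD('n), and its normalized Haar measure. *)

definition unitary_group :: "(complex ^ 'n ^ 'n) set" where
  "unitary_group = {M. map_matrix cnj (transpose M) ** M = mat 1}"

definition normalized_haar_measure :: "(complex ^ 'n ^ 'n) measure \<Rightarrow> bool" where
  "normalized_haar_measure H \<longleftrightarrow>
     sets H = sets (restrict_space borel unitary_group) \<and>
     emeasure H (space H) = 1 \<and>
     (\<forall>U\<in>unitary_group. \<forall>A\<in>sets H. emeasure H ((**) U ` A) = emeasure H A)"

definition charpoly :: "complex ^ 'n ^ 'n \<Rightarrow> complex poly" where
  "charpoly M = det (mat [:0, 1:] - map_matrix (\<lambda>c. [:c:]) M)"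

definition eigenvalues :: "complex ^ 'n ^ 'n \<Rightarrow> complex multiset" where
  "eigenvalues M = proots (charpoly M)"

(* Complete homogeneous symmetric polynomials, from their generating function
   (SUM k. h_k(X) t^k) = (PROD x : X. 1 / (1 - x t)). *)
definition complete_homogeneous :: "int \<Rightarrow> complex multiset \<Rightarrow> complex" where
  "complete_homogeneous k X =
     (if k < 0 then 0
      else fps_nth (\<Prod>x\<in>#X. inverse (1 - fps_const x * fps_X)) (nat k))"

(* A partition with at most n rows is encoded by l 1, ..., l n; the values of l outside
   {1..n} are never used.  Entries are integers so that l - e_i always makes sense. *)
definition is_partition :: "nat \<Rightarrow> (nat \<Rightarrow> int) \<Rightarrow> bool" where
  "is_partition n l \<longleftrightarrow> (\<forall>i\<in>{1..n}. 0 \<le> l i) \<and> (\<forall>i\<in>{1..<n}. l (i + 1) \<le> l i)"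

definition add_unit :: "(nat \<Rightarrow> int) \<Rightarrow> nat \<Rightarrow> nat \<Rightarrow> int"  (infixl \<open>\<oplus>e\<close> 65) where
  "l \<oplus>e i = l(i := l i + 1)"

definition sub_unit :: "(nat \<Rightarrow> int) \<Rightarrow> nat \<Rightarrow> nat \<Rightarrow> int"  (infixl \<open>\<ominus>e\<close> 65) where
  "l \<ominus>e i = l(i := l i - 1)"

(* Jacobi-Trudi: det (h_{l_i - i + j}), 1 <= i, j <= n.  The row and column indices of
   the matrix start at 0, hence the shift in the argument of l. *)
definition schur :: "nat \<Rightarrow> (nat \<Rightarrow> int) \<Rightarrow> complex multiset \<Rightarrow> complex" where
  "schur n l X =
     Determinant.det (Matrix.mat n n
       (\<lambda>(i, j). complete_homogeneous (l (i + 1) - int i + int j) X))"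

definition schur_mat :: "(nat \<Rightarrow> int) \<Rightarrow> complex ^ 'n ^ 'n \<Rightarrow> complex" where
  "schur_mat l M = schur CARD('n) l (eigenvalues M)"

(* The integrals below satisfy a difference equation in l and m which contains, for p ~= q,
   a term n (p - q) z a_{l m}(z) that is missing from the published formula.  It cannot be
   dropped: for n = 1, p = 1, q = 0 and l = m = 0 one has a_{l m} = 1, a_{l + e_1, m} = 0,
   a_{l, m + e_1} = z, and the equation without this term would read -z = 0. *)
definition a_coeff ::
  "(complex ^ 'n ^ 'n) measure \<Rightarrow> nat \<Rightarrow> nat \<Rightarrow> (nat \<Rightarrow> int) \<Rightarrow> (nat \<Rightarrow> int) \<Rightarrow> complex \<Rightarrow> complex"
where
  "a_coeff H p q l m z =
     (if is_partition CARD('n) l \<and> is_partition CARD('n) m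
      then (LINT M|H. schur_mat l M * schur_mat m (map_matrix cnj M)
              * det (mat 1 + map_matrix ((*) z) M) ^ p
              * det (mat 1 + map_matrix ((*) z) (map_matrix cnj M)) ^ q)
      else 0)"

(* The bijection x_i = l_{n-i+1} + i - 1 and its inverse. *)

definition positions :: "nat \<Rightarrow> (nat \<Rightarrow> int) \<Rightarrow> nat \<Rightarrow> int" where
  "positions n l i = l (n - i + 1) + int i - 1"

definition shape :: "nat \<Rightarrow> (nat \<Rightarrow> int) \<Rightarrow> nat \<Rightarrow> int" where
  "shape n x i = x (n - i + 1) - int (n - i)"

definition increasing :: "nat \<Rightarrow> (nat \<Rightarrow> int) \<Rightarrow> bool" where
  "increasing n x \<longleftrightarrow> (\<forall>i\<in>{1..<n}. x i < x (i + 1))"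

definition b_coeff ::
  "(complex ^ 'n ^ 'n) measure \<Rightarrow> nat \<Rightarrow> nat \<Rightarrow> int \<Rightarrow> (nat \<Rightarrow> int) \<Rightarrow> (nat \<Rightarrow> int) \<Rightarrow> complex"
where
  "b_coeff H p q k x y =
     (if 0 \<le> k \<and> increasing CARD('n) x \<and> increasing CARD('n) y
      then fps_nth (fps_expansion (a_coeff H p q (shape CARD('n) x) (shape CARD('n) y)) 0) (nat k)
      else 0)"

end

theory Submission
  imports Defs "HOL-Computational_Algebra.Fundamental_Theorem_Algebra"
begin

text \<open>
  The difference equation expresses the invariance of Haar measure: a vector field on the unitary
  group, applied to a function and corrected by its divergence, integrates to zero. The field is
  \<open>(z + M)(1 + zM) = z + (1 + z^2) M + z M^2\<close>, applied to
  \<open>F = s_l(M) det(1 + zM)^p\<close> and \<open>K = s_m(M) det(1 + cnj z M)^q\<close>, whose product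
  \<open>F cnj(K)\<close> is the integrand. It acts through the derivative of \<open>F\<close> minus the conjugate of the
  corresponding derivative of \<open>K\<close> (\<open>ibp_field\<close>). Differentiating \<open>det(1 + zM)^p\<close> along it
  produces the factor \<open>p z tr(z + M)\<close> without a denominator (\<open>det1_field\<close>).

  The field has three components, with directions \<open>1\<close>, \<open>M\<close> and \<open>M^2\<close>. In terms of the eigenvalues
  \<open>u_i\<close> they are the operators \<open>\<Sum> d/du_i\<close>, \<open>\<Sum> u_i d/du_i\<close> and \<open>\<Sum> u_i^2 d/du_i\<close>, and on a
  Schur function they give, with \<open>L_i = l_i - i + n\<close>,
  \<open>\<Sum> L_i s_(l - e_i)\<close>, \<open>|l| s_l\<close> and \<open>\<Sum> L_i s_(l + e_i) - (n - 1) tr(M) s_l\<close>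
  (\<open>schur_deriv_1\<close>, \<open>schur_deriv_self\<close>, \<open>schur_deriv_square\<close>). The multiples of \<open>z tr(M) s_l\<close> are
  \<open>n\<close> from the divergence, \<open>-(n - 1)\<close> from the Schur function and \<open>p\<close> from the determinant. Since
  \<open>tr(M) s_l = \<Sum> s_(l + e_i)\<close> (\<open>pieri\<close>), they turn the coefficient \<open>L_i\<close> of \<open>s_(l + e_i)\<close> into
  \<open>L_i + p + 1\<close>. The summand \<open>p z tr(z)\<close> gives \<open>n p z^2\<close>, and the conjugate factor \<open>n q z^2\<close>; after
  division by \<open>z\<close> their difference is the term \<open>n (p - q) z\<close>.

  The formulas for Schur functions come from the Jacobi-Trudi determinant. Newton's identities make
  each \<open>h_k\<close> a polynomial in the matrix entries, and its derivative in the direction \<open>1\<close>, \<open>M\<close> or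
  \<open>M^2\<close> is a multiple of \<open>h_(k - 1)\<close>, of \<open>h_k\<close>, or of \<open>h_(k + 1)\<close> up to \<open>tr(M) h_k\<close>. The multiplier
  is a function of the row plus a function of the column. In the derivative of the determinant the
  row parts shift one row of the partition, and the column parts nearly all produce equal columns.

  Finally, the integral is a polynomial in \<open>z\<close>, and the equation for its coefficients is obtained
  by comparing powers of \<open>z\<close>.
\<close>

no_notation Matrix.vec_index (infixl \<open>$\<close> 100) and fps_nth (infixl \<open>$\<close> 75)

section \<open>Variations of determinants\<close>

text \<open>The derivative of the determinant at A in the direction A', written out term by term so that
  it makes sense over any ring and applies to a formal derivative as well as to an analytic
  one.\<close>

definition det_variation :: "'a::comm_ring_1 ^ 'n ^ 'n \<Rightarrow> 'a ^ 'n ^ 'n \<Rightarrow> 'a" where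
  "det_variation A A' = (\<Sum>p | p permutes UNIV. of_int (sign p) *
     (\<Sum>i\<in>UNIV. A' $ i $ p i * (\<Prod>j\<in>UNIV - {i}. A $ j $ p j)))"

lemma det_variation_rows:
  "det_variation A A' = (\<Sum>i\<in>UNIV. det (\<chi> k. if k = i then A' $ k else A $ k))"
proof -
  have "A' $ i $ p i * (\<Prod>j\<in>UNIV - {i}. A $ j $ p j)
      = (\<Prod>j\<in>UNIV. (\<chi> k. if k = i then A' $ k else A $ k) $ j $ p j)" for i p
    by (subst prod.remove[of UNIV i]) (auto intro!: prod.cong arg_cong2[where f="(*)"])
  then show ?thesis
    unfolding det_variation_def Determinants.det_def
    by (simp only: sum_distrib_left) (rule sum.swap)
qed

text \<open>Replacing the i-th row of A by the i-th row of CA and expanding by linearity, only the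
  multiple C_ii of the old row survives, the others produce two equal rows. With the direction
  written as CA, the formula needs no inverse of A and holds at singular A as well.\<close>

lemma det_variation_mult:
  fixes A C :: "'a::comm_ring_1 ^ 'n ^ 'n"
  shows "det_variation A (C ** A) = trace C * det A"
proof -
  have "det (\<chi> k. if k = i then (C ** A) $ k else A $ k) = C $ i $ i * det A" for i
  proof -
    have row: "(C ** A) $ k = (\<Sum>j\<in>UNIV. C $ k $ j *s A $ j)" for k
      by (simp add: Finite_Cartesian_Product.vec_eq_iff matrix_matrix_mult_def sum_component)
    have "det (\<chi> k. if k = i then (C ** A) $ k else A $ k)
        = (\<Sum>j\<in>UNIV. det (\<chi> k. if k = i then C $ k $ j *s A $ j else A $ k))"
      unfolding row by (rule det_linear_row_sum) simp
    also have "\<dots> = (\<Sum>j\<in>UNIV. C $ i $ j * det (\<chi> k. if k = i then A $ j else A $ k))"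
    proof (rule sum.cong[OF refl])
      fix j
      have "(\<chi> k. if k = i then C $ k $ j *s A $ j else A $ k)
          = (\<chi> k. if k = i then C $ i $ j *s A $ j else A $ k)"
        by (simp add: Finite_Cartesian_Product.vec_eq_iff)
      then show "det (\<chi> k. if k = i then C $ k $ j *s A $ j else A $ k)
          = C $ i $ j * det (\<chi> k. if k = i then A $ j else A $ k)"
        using det_row_mul[of i "C $ i $ j" "\<lambda>_. A $ j" "\<lambda>k. A $ k"] by simp
    qed
    also have "\<dots> = (\<Sum>j\<in>UNIV. if j = i then C $ i $ i * det A else 0)"
    proof (rule sum.cong[OF refl])
      fix j
      have "det (\<chi> k. if k = i then A $ j else A $ k) = (if j = i then det A else 0)"
      proof (cases "j = i")
        case True
        then have "(\<chi> k. if k = i then A $ j else A $ k) = A" by (simp add: Finite_Cartesian_Product.vec_eq_iff)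
        with True show ?thesis by simp
      next
        case False
        then show ?thesis
          by (simp, intro Determinants.det_identical_rows[of i j]) (auto simp: Finite_Cartesian_Product.row_def)
      qed
      then show "C $ i $ j * det (\<chi> k. if k = i then A $ j else A $ k)
          = (if j = i then C $ i $ i * det A else 0)" by simp
    qed
    finally show ?thesis by simp
  qed
  then show ?thesis
    by (simp add: det_variation_rows trace_def sum_distrib_right)
qed

abbreviation fdet :: "nat \<Rightarrow> (nat \<Rightarrow> nat \<Rightarrow> 'a::comm_ring_1) \<Rightarrow> 'a" where
  "fdet n a \<equiv> Determinant.det (Matrix.mat n n (\<lambda>(i, j). a i j))"

lemma permutes_lt: "p permutes {0..<n} \<Longrightarrow> i < n \<Longrightarrow> p i < n" for n :: nat
  using permutes_in_image[of p "{0..<n}" i] by simp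

lemma fdet_eq:
  "fdet n a = (\<Sum>p | p permutes {0..<n}. signof p * (\<Prod>i=0..<n. a i (p i)))"
  by (subst Determinant.det_def) (auto intro!: sum.cong prod.cong simp: permutes_lt)

text \<open>The analogue of \<open>det_variation\<close> for a matrix whose size is a number. Each term
  chooses one entry of a permutation product, and that choice may be booked under its row or
  under its column. Equating the two countings is what turns scalar identities between the h_k
  into identities between Schur functions.\<close>

definition fdet_variation where
  "fdet_variation n a a' = (\<Sum>p | p permutes {0..<n}. signof p *
     (\<Sum>i=0..<n. a' i (p i) * (\<Prod>j\<in>{0..<n} - {i}. a j (p j))))"

lemma fdet_variation_rows:
  "fdet_variation n a a' = (\<Sum>i=0..<n. fdet n (a(i := a' i)))"
proof -
  have "a' i (p i) * (\<Prod>j\<in>{0..<n} - {i}. a j (p j)) = (\<Prod>j=0..<n. (a(i := a' i)) j (p j))"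
    if "i < n" for i p
    using that by (subst prod.remove[of _ i]) (auto intro!: prod.cong arg_cong2[where f="(*)"])
  then show ?thesis
    unfolding fdet_variation_def fdet_eq by (subst sum.swap) (simp add: sum_distrib_left)
qed

lemma fdet_variation_cols:
  "fdet_variation n a a' = (\<Sum>c=0..<n. fdet n (\<lambda>i j. if j = c then a' i j else a i j))"
proof -
  have "(\<Sum>i=0..<n. a' i (p i) * (\<Prod>j\<in>{0..<n} - {i}. a j (p j)))
      = (\<Sum>c=0..<n. \<Prod>j=0..<n. if p j = c then a' j (p j) else a j (p j))"
    if p: "p permutes {0..<n}" for p
  proof -
    have "(\<Sum>c=0..<n. \<Prod>j=0..<n. if p j = c then a' j (p j) else a j (p j))
        = (\<Sum>i=0..<n. \<Prod>j=0..<n. if p j = p i then a' j (p j) else a j (p j))"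
      by (rule sum.reindex_bij_betw[OF permutes_imp_bij[OF p], symmetric])
    also have "\<dots> = (\<Sum>i=0..<n. a' i (p i) * (\<Prod>j\<in>{0..<n} - {i}. a j (p j)))"
    proof (rule sum.cong[OF refl])
      fix i assume "i \<in> {0..<n}"
      then show "(\<Prod>j=0..<n. if p j = p i then a' j (p j) else a j (p j))
          = a' i (p i) * (\<Prod>j\<in>{0..<n} - {i}. a j (p j))"
        by (subst prod.remove[of _ i])
          (auto intro!: prod.cong arg_cong2[where f="(*)"] simp: inj_eq[OF permutes_inj[OF p]])
    qed
    finally show ?thesis by simp
  qed
  then show ?thesis
    unfolding fdet_variation_def fdet_eq
    by (subst sum.swap) (auto intro!: sum.cong simp: sum_distrib_left)
qed

lemma fdet_variation_add:
  "fdet_variation n a (\<lambda>i j. b i j + c i j) = fdet_variation n a b + fdet_variation n a c"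
  by (simp add: fdet_variation_def ring_distribs sum.distrib)

lemma fdet_variation_cmult:
  "fdet_variation n a (\<lambda>i j. s * b i j) = s * fdet_variation n a b"
  by (simp add: fdet_variation_def sum_distrib_left mult_ac)

lemma fdet_row_mult:
  assumes "i < n"
  shows "fdet n (a(i := \<lambda>j. s * b j)) = s * fdet n (a(i := b))"
proof -
  have "(\<Prod>k=0..<n. (a(i := \<lambda>j. s * b j)) k (p k)) = s * (\<Prod>k=0..<n. (a(i := b)) k (p k))" for p
    using assms by (subst (1 2) prod.remove[of _ i]) (auto simp: mult_ac intro!: prod.cong arg_cong2[where f="(*)"])
  then show ?thesis
    unfolding fdet_eq by (simp add: sum_distrib_left mult_ac)
qed

lemma fdet_col_sum:
  fixes a :: "nat \<Rightarrow> nat \<Rightarrow> 'a::comm_ring_1"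
  assumes "c < n" "finite S"
  shows "fdet n (\<lambda>i j. if j = c then (\<Sum>k\<in>S. s k * b k i) else a i j)
    = (\<Sum>k\<in>S. s k * fdet n (\<lambda>i j. if j = c then b k i else a i j))"
proof -
  have *: "(\<Prod>i=0..<n. if p i = c then f i else a i (p i))
       = f (inv_into UNIV p c) * (\<Prod>i\<in>{0..<n} - {inv_into UNIV p c}. a i (p i))"
    if p: "p permutes {0..<n}" for p and f :: "nat \<Rightarrow> 'a"
  proof -
    have i: "inv_into UNIV p c < n" "p (inv_into UNIV p c) = c"
      using assms permutes_lt[OF permutes_inv[OF p]] permutes_inverses[OF p] by auto
    have "p i \<noteq> c" if "i \<noteq> inv_into UNIV p c" for i
      using that permutes_inverses[OF p] by auto
    then show ?thesis using i
      by (subst prod.remove[of _ "inv_into UNIV p c"])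
         (auto intro!: prod.cong arg_cong2[where f="(*)"])
  qed
  define R where "R p = (\<Prod>i\<in>{0..<n} - {inv_into UNIV p c}. a i (p i))" for p
  have col: "fdet n (\<lambda>i j. if j = c then f i else a i j)
     = (\<Sum>p | p permutes {0..<n}. signof p * (f (inv_into UNIV p c) * R p))" for f
    unfolding fdet_eq R_def
  proof (intro sum.cong refl)
    fix p assume "p \<in> {p. p permutes {0..<n}}"
    then show "signof p * (\<Prod>i=0..<n. if p i = c then f i else a i (p i)) = signof p *
        (f (inv_into UNIV p c) * (\<Prod>i\<in>{0..<n} - {inv_into UNIV p c}. a i (p i)))"
      using *[of p f] by simp
  qed
  have "(\<Sum>p | p permutes {0..<n}. signof p * ((\<Sum>k\<in>S. s k * b k (inv_into UNIV p c)) * R p))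
      = (\<Sum>p | p permutes {0..<n}. \<Sum>k\<in>S. s k * (signof p * (b k (inv_into UNIV p c) * R p)))"
    by (simp add: sum_distrib_left sum_distrib_right mult_ac)
  also have "\<dots> = (\<Sum>k\<in>S. \<Sum>p | p permutes {0..<n}. s k * (signof p * (b k (inv_into UNIV p c) * R p)))"
    by (rule sum.swap)
  finally show ?thesis
    unfolding col by (simp add: sum_distrib_left)
qed

lemma fdet_identical_cols:
  assumes "c < n" "d < n" "c \<noteq> d" "\<And>i. i < n \<Longrightarrow> a i c = a i d"
  shows "fdet n a = 0"
  by (rule Determinant.det_identical_columns[of _ n c d])
     (use assms in \<open>auto intro!: eq_vecI\<close>)

lemma fdet_identical_rows:
  assumes "c < n" "d < n" "c \<noteq> d" "\<And>j. j < n \<Longrightarrow> a c j = a d j"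
  shows "fdet n a = 0"
  by (rule Determinant.det_identical_rows[of _ n c d])
     (use assms in \<open>auto intro!: eq_vecI\<close>)

section \<open>The generating series of the complete homogeneous polynomials\<close>

lemma (in comm_ring_hom) hom_det_vec:
  fixes A :: "'a ^ 'n ^ 'n"
  shows "hom (det A) = det (map_matrix hom A)"
proof -
  have "hom (of_int (sign p)) = of_int (sign p)" for p :: "'n \<Rightarrow> 'n"
    by (simp add: sign_def hom_uminus)
  then show ?thesis
    by (simp add: Determinants.det_def hom_sum hom_prod hom_mult)
qed

lemma poly_eval_hom: "comm_ring_hom (\<lambda>p. poly p (a::'a::comm_ring_1))"
  by unfold_locales auto

lemma fps_of_poly_hom: "comm_ring_hom (fps_of_poly :: 'a::comm_ring_1 poly \<Rightarrow> 'a fps)"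
  by unfold_locales (auto simp: fps_of_poly_simps)

definition rev_charpoly :: "complex ^ 'n ^ 'n \<Rightarrow> complex poly" where
  "rev_charpoly M = det (mat 1 - map_matrix (\<lambda>c. [:0, c:]) M)"

lemma poly_rev_charpoly: "poly (rev_charpoly M) t = det (mat 1 - map_matrix ((*) t) M)"
proof -
  interpret comm_ring_hom "\<lambda>p. poly p t" by (rule poly_eval_hom)
  have "map_matrix (\<lambda>p. poly p t) (mat 1 - map_matrix (\<lambda>c. [:0, c:]) M)
      = mat 1 - map_matrix ((*) t) M"
    by (simp add: Finite_Cartesian_Product.vec_eq_iff Finite_Cartesian_Product.mat_def)
  then show ?thesis
    by (simp add: rev_charpoly_def hom_det_vec)
qed

lemma poly_charpoly: "poly (charpoly M) a = det (mat a - M)"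
proof -
  interpret comm_ring_hom "\<lambda>p. poly p a" by (rule poly_eval_hom)
  have "map_matrix (\<lambda>p. poly p a) (mat [:0, 1:] - map_matrix (\<lambda>c. [:c:]) M) = mat a - M"
    by (simp add: Finite_Cartesian_Product.vec_eq_iff Finite_Cartesian_Product.mat_def)
  then show ?thesis
    by (simp add: charpoly_def hom_det_vec)
qed

lemma det_cmult_vec:
  fixes A :: "'a::comm_ring_1 ^ 'n ^ 'n"
  shows "det (map_matrix ((*) c) A) = c ^ CARD('n) * det A"
  by (simp add: Determinants.det_def prod.distrib sum_distrib_left mult_ac)

text \<open>Homogenization: det(1 - tM) is the characteristic polynomial read backwards.\<close>

lemma poly_charpoly_inverse:
  fixes M :: "complex ^ 'n ^ 'n"
  assumes "t \<noteq> 0"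
  shows "poly (rev_charpoly M) t = t ^ CARD('n) * poly (charpoly M) (inverse t)"
proof -
  have "mat 1 - map_matrix ((*) t) M = map_matrix ((*) t) (mat (inverse t) - M)"
    using assms
    by (simp add: Finite_Cartesian_Product.vec_eq_iff Finite_Cartesian_Product.mat_def algebra_simps)
  then show ?thesis
    by (simp add: poly_rev_charpoly poly_charpoly det_cmult_vec)
qed

lemma degree_rev_charpoly: "degree (rev_charpoly (M :: complex ^ 'n ^ 'n)) \<le> CARD('n)"
proof -
  have deg: "degree ((mat 1 - map_matrix (\<lambda>c. [:0, c:]) M) $ i $ j) \<le> 1" for i j
    by (simp add: Finite_Cartesian_Product.mat_def)
       (intro impI order.trans[OF degree_diff_le_max] max.boundedI; simp)
  have "degree (of_int (sign p) *
      (\<Prod>i\<in>UNIV. (mat 1 - map_matrix (\<lambda>c. [:0, c:]) M) $ i $ p i)) \<le> CARD('n)"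
    (is "degree (_ * ?P) \<le> _") for p :: "'n \<Rightarrow> 'n"
  proof -
    have "degree ?P \<le> (\<Sum>i\<in>UNIV. degree ((mat 1 - map_matrix (\<lambda>c. [:0, c:]) M) $ i $ p i))"
      using degree_prod_sum_le[of UNIV "\<lambda>i. (mat 1 - map_matrix (\<lambda>c. [:0, c:]) M) $ i $ p i"]
      by (simp add: o_def)
    also have "\<dots> \<le> (\<Sum>i\<in>(UNIV::'n set). 1)"
      by (intro sum_mono deg)
    finally show ?thesis
      by (simp add: sign_def)
  qed
  then show ?thesis
    unfolding rev_charpoly_def Determinants.det_def by (intro degree_sum_le) simp_all
qed

lemma rev_charpoly_0: "coeff (rev_charpoly M) 0 = 1"
proof -
  have "map_matrix ((*) 0) M = 0"
    by (simp add: Finite_Cartesian_Product.vec_eq_iff)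
  then have "poly (rev_charpoly M) 0 = 1"
    by (simp add: poly_rev_charpoly)
  then show ?thesis by (simp add: poly_0_coeff_0)
qed

text \<open>Read off from the reversed polynomial, whose degree is at most n and whose constant term is
  1, by comparing values at all nonzero points.\<close>

lemma charpoly_monic:
  fixes M :: "complex ^ 'n ^ 'n"
  shows "degree (charpoly M) = CARD('n)" "lead_coeff (charpoly M) = 1"
proof -
  \<comment> \<open>the reversal of the coefficients, with respect to the exponent \<open>n\<close>\<close>
  define Q where "Q = (\<Sum>c\<le>CARD('n). monom (coeff (rev_charpoly M) c) (CARD('n) - c))"
  have "poly (charpoly M) a = poly Q a" if "a \<noteq> 0" for a
  proof -
    have "poly (rev_charpoly M) (inverse a) = (\<Sum>c\<le>CARD('n). coeff (rev_charpoly M) c * inverse a ^ c)"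
      unfolding poly_altdef
      by (rule sum.mono_neutral_left) (auto simp: degree_rev_charpoly coeff_eq_0)
    then have "poly (charpoly M) a
        = a ^ CARD('n) * (\<Sum>c\<le>CARD('n). coeff (rev_charpoly M) c * inverse a ^ c)"
      using poly_charpoly_inverse[of "inverse a" M] that by (simp add: field_simps)
    also have "\<dots> = (\<Sum>c\<le>CARD('n). coeff (rev_charpoly M) c * a ^ (CARD('n) - c))"
      using that by (auto simp: sum_distrib_left power_diff field_simps intro!: sum.cong)
    finally show ?thesis
      by (simp add: Q_def poly_sum poly_monom)
  qed
  then have "- {0} \<subseteq> {a. poly (charpoly M - Q) a = 0}"
    by auto
  moreover have "infinite (- {0::complex})"
    by (simp add: infinite_UNIV_char_0 Compl_eq_Diff_UNIV)
  ultimately have eq: "charpoly M = Q"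
    by (metis poly_roots_finite finite_subset right_minus_eq)
  have deg: "degree Q \<le> CARD('n)"
    unfolding Q_def by (intro degree_sum_le) (auto intro: order.trans[OF degree_monom_le])
  have "coeff Q (CARD('n)) = (\<Sum>c\<le>CARD('n). if c = 0 then coeff (rev_charpoly M) c else 0)"
    unfolding Q_def coeff_sum by (intro sum.cong) auto
  then have "coeff Q (CARD('n)) = 1"
    by (simp add: rev_charpoly_0)
  moreover from this have "degree Q = CARD('n)"
    using deg le_degree[of Q "CARD('n)"] by simp
  ultimately show "degree (charpoly M) = CARD('n)" "lead_coeff (charpoly M) = 1"
    by (simp_all add: eq)
qed

lemma rev_charpoly_eigenvalues:
  fixes M :: "complex ^ 'n ^ 'n"
  shows "rev_charpoly M = (\<Prod>x\<in>#eigenvalues M. [:1, - x:])"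
proof -
  have size: "size (eigenvalues M) = CARD('n)"
    by (simp add: eigenvalues_def size_proots_complex charpoly_monic)
  have "poly (rev_charpoly M) t = poly (\<Prod>x\<in>#eigenvalues M. [:1, - x:]) t" for t
  proof (cases "t = 0")
    case True
    then show ?thesis
      using rev_charpoly_0[of M] by (simp add: poly_prod_mset poly_0_coeff_0[symmetric])
  next
    case False
    have "charpoly M = (\<Prod>x\<in>#eigenvalues M. [:-x, 1:])"
      using complex_poly_decompose_multiset[of "charpoly M"]
      unfolding charpoly_monic(2) eigenvalues_def by simp
    then have "poly (charpoly M) (inverse t) = (\<Prod>x\<in>#eigenvalues M. inverse t - x)"
      by (simp add: poly_prod_mset)
    then have "poly (rev_charpoly M) t = (\<Prod>x\<in>#eigenvalues M. t) * (\<Prod>x\<in>#eigenvalues M. inverse t - x)"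
      using poly_charpoly_inverse[OF False, of M] by (simp add: size prod_mset_constant)
    also have "\<dots> = (\<Prod>x\<in>#eigenvalues M. t * (inverse t - x))"
      by (rule prod_mset.distrib[symmetric])
    finally show ?thesis
      using False by (simp add: poly_prod_mset algebra_simps)
  qed
  then show ?thesis by (simp add: poly_eq_poly_eq_iff[symmetric] ext)
qed

text \<open>The generating series 1 / det(1 - tM) of the h_k(M).\<close>

definition hom_series :: "complex ^ 'n ^ 'n \<Rightarrow> complex fps" where
  "hom_series M = inverse (fps_of_poly (rev_charpoly M))"

lemma complete_homogeneous_eigenvalues:
  "complete_homogeneous k (eigenvalues M) = (if k < 0 then 0 else fps_nth (hom_series M) (nat k))"
proof -
  have "(\<Prod>x\<in>#X. inverse (1 - fps_const x * fps_X)) = inverse (fps_of_poly (\<Prod>x\<in>#X. [:1, - x:]))"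
    for X :: "complex multiset"
    by (induction X)
      (simp_all add: fps_of_poly_mult fps_inverse_mult fps_of_poly_linear' del: mult_pCons_left
        flip: fps_const_neg)
  then show ?thesis
    by (simp add: complete_homogeneous_def hom_series_def rev_charpoly_eigenvalues)
qed

primrec mpow :: "'a::semiring_1 ^ 'n ^ 'n \<Rightarrow> nat \<Rightarrow> 'a ^ 'n ^ 'n" where
  "mpow M 0 = mat 1"
| "mpow M (Suc k) = M ** mpow M k"

lemma mpow_commute: "mpow M k ** M = M ** mpow M k"
  by (induction k) (simp_all add: matrix_mul_assoc[symmetric])

text \<open>The logarithmic derivative of \<open>hom_series\<close>, whose coefficients are the power
  sums of the eigenvalues.\<close>

definition power_sum_series :: "complex ^ 'n ^ 'n \<Rightarrow> complex fps" where
  "power_sum_series M = Abs_fps (\<lambda>k. trace (mpow M (Suc k)))"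

lemma fps_deriv_det:
  "fps_deriv (det A) = det_variation A (map_matrix fps_deriv (A :: complex fps ^ 'n ^ 'n))"
proof -
  have prod: "fps_deriv (\<Prod>i\<in>S. f i) = (\<Sum>i\<in>S. fps_deriv (f i) * (\<Prod>j\<in>S - {i}. f j))"
    if "finite S" for S :: "'n set" and f :: "'n \<Rightarrow> complex fps"
    using that
  proof induction
    case (insert x S)
    have "(\<Sum>i\<in>S. fps_deriv (f i) * (\<Prod>j\<in>insert x S - {i}. f j))
        = (\<Sum>i\<in>S. f x * (fps_deriv (f i) * (\<Prod>j\<in>S - {i}. f j)))"
    proof (rule sum.cong[OF refl])
      fix i assume "i \<in> S"
      then have "insert x S - {i} = insert x (S - {i})" "x \<notin> S - {i}"
        using insert by auto
      then show "fps_deriv (f i) * (\<Prod>j\<in>insert x S - {i}. f j)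
          = f x * (fps_deriv (f i) * (\<Prod>j\<in>S - {i}. f j))"
        using insert by (simp add: mult_ac)
    qed
    then show ?case
      using insert by (simp add: sum_distrib_left algebra_simps)
  qed simp
  have "fps_deriv (of_int (sign p) * g) = of_int (sign p) * fps_deriv g" for p :: "'n \<Rightarrow> 'n" and g :: "complex fps"
    by (simp add: sign_def)
  then show ?thesis
    by (simp add: Determinants.det_def det_variation_def fps_deriv_sum prod)
qed

text \<open>The derivative of the entries of 1 - tM is -M = -(MR)(1 - tM), where R is the geometric
  series of tM. The logarithmic derivative of det(1 - tM) is therefore -tr(MR).\<close>

lemma fps_deriv_hom_series:
  fixes M :: "complex ^ 'n ^ 'n"
  shows "fps_deriv (hom_series M) = power_sum_series M * hom_series M"
proof -
  define A where "A = map_matrix fps_of_poly (mat 1 - map_matrix (\<lambda>c. [:0, c:]) M)"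
  define C where "C = map_matrix fps_const M"
  define R where "R = (\<chi> i j. Abs_fps (\<lambda>k. mpow M k $ i $ j))"
  interpret comm_ring_hom "fps_of_poly :: complex poly \<Rightarrow> complex fps" by (rule fps_of_poly_hom)
  have det: "fps_of_poly (rev_charpoly M) = det A"
    by (simp add: rev_charpoly_def A_def hom_det_vec)
  have A: "A $ i $ j = of_bool (i = j) - fps_const (M $ i $ j) * fps_X" for i j
    by (simp add: A_def Finite_Cartesian_Product.mat_def fps_of_poly_diff fps_of_poly_pCons)
  have CR: "(C ** R) $ i $ j = Abs_fps (\<lambda>k. mpow M (Suc k) $ i $ j)" for i j
    by (rule fps_ext) (simp add: C_def R_def matrix_matrix_mult_def fps_sum_nth)
  have "(R ** A) $ i $ j = (mat 1) $ i $ j" for i j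
  proof -
    have "(R ** A) $ i $ j = R $ i $ j - (\<Sum>k\<in>UNIV. R $ i $ k * fps_const (M $ k $ j)) * fps_X"
      by (simp add: matrix_matrix_mult_def A algebra_simps sum_subtractf sum_distrib_left)
    also have "(\<Sum>k\<in>UNIV. R $ i $ k * fps_const (M $ k $ j)) = Abs_fps (\<lambda>m. mpow M (Suc m) $ i $ j)"
    proof (rule fps_ext)
      fix m
      have "fps_nth (\<Sum>k\<in>UNIV. R $ i $ k * fps_const (M $ k $ j)) m = (mpow M m ** M) $ i $ j"
        by (simp add: R_def matrix_matrix_mult_def fps_sum_nth)
      then show "fps_nth (\<Sum>k\<in>UNIV. R $ i $ k * fps_const (M $ k $ j)) m
          = fps_nth (Abs_fps (\<lambda>m. mpow M (Suc m) $ i $ j)) m"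
        by (simp add: mpow_commute)
    qed
    also have "R $ i $ j - Abs_fps (\<lambda>m. mpow M (Suc m) $ i $ j) * fps_X = fps_const ((mat 1 :: complex ^ 'n ^ 'n) $ i $ j)"
    proof (rule fps_ext)
      fix m
      show "fps_nth (R $ i $ j - Abs_fps (\<lambda>m. mpow M (Suc m) $ i $ j) * fps_X) m
          = fps_nth (fps_const ((mat 1 :: complex ^ 'n ^ 'n) $ i $ j)) m"
        by (cases m) (simp_all add: R_def)
    qed
    also have "\<dots> = (mat 1) $ i $ j"
      by (simp add: Finite_Cartesian_Product.mat_def)
    finally show ?thesis .
  qed
  then have RA: "R ** A = mat 1"
    by (simp add: Finite_Cartesian_Product.vec_eq_iff)
  have "(- X) ** A = - (X ** A)" for X :: "complex fps ^ 'n ^ 'n"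
    by (simp add: Finite_Cartesian_Product.vec_eq_iff matrix_matrix_mult_def sum_negf)
  then have neg: "(- (C ** R)) ** A = - (C ** (R ** A))"
    by (simp add: matrix_mul_assoc)
  have "map_matrix fps_deriv A = - C"
    by (simp add: Finite_Cartesian_Product.vec_eq_iff A C_def)
  also have "\<dots> = (- (C ** R)) ** A"
    using RA by (simp add: matrix_mul_assoc[symmetric] neg)
  finally have "fps_deriv (det A) = trace (- (C ** R)) * det A"
    by (simp add: fps_deriv_det det_variation_mult)
  also have "trace (- (C ** R)) = - power_sum_series M"
    by (rule fps_ext) (simp add: trace_def CR power_sum_series_def fps_sum_nth sum_negf)
  finally have *: "fps_deriv (det A) = - (power_sum_series M * det A)"
    by simp
  have "fps_nth (det A) 0 \<noteq> 0"
    using rev_charpoly_0[of M] by (simp add: det[symmetric])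
  then show ?thesis
    using inverse_mult_eq_1[of "det A"]
    by (simp add: hom_series_def det fps_inverse_deriv * power2_eq_square mult_ac)
qed

section \<open>Directional derivatives of polynomial functions of a matrix\<close>

abbreviation cscale :: "complex \<Rightarrow> complex ^ 'n ^ 'n \<Rightarrow> complex ^ 'n ^ 'n" where
  "cscale c \<equiv> map_matrix ((*) c)"

text \<open>Complex differentiability of F with derivative F' M X at M in the direction X, phrased as a
  real derivative that is homogeneous over the complex numbers. Joint continuity in M and X
  gives the bounds over the unitary group that differentiation under the integral requires.\<close>

definition holo ::
  "(complex ^ 'n ^ 'n \<Rightarrow> complex) \<Rightarrow> (complex ^ 'n ^ 'n \<Rightarrow> complex ^ 'n ^ 'n \<Rightarrow> complex) \<Rightarrow> bool"
where
  "holo F F' \<longleftrightarrow> (\<forall>M. (F has_derivative F' M) (at M)) \<and>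
     (\<forall>M c X. F' M (cscale c X) = c * F' M X) \<and>
     continuous_on UNIV (\<lambda>p. F' (fst p) (snd p))"

lemma holo_has_derivative: "holo F F' \<Longrightarrow> (F has_derivative F' M) (at M)"
  and holo_cscale: "holo F F' \<Longrightarrow> F' M (cscale c X) = c * F' M X"
  and holo_continuous': "holo F F' \<Longrightarrow> continuous_on UNIV (\<lambda>p. F' (fst p) (snd p))"
  by (auto simp: holo_def)

lemma holo_continuous: "holo F F' \<Longrightarrow> continuous_on UNIV F"
  by (intro has_derivative_continuous_on) (auto simp: holo_def intro: has_derivative_at_withinI)

lemma holo_linear: "holo F F' \<Longrightarrow> linear (F' M)"
  by (blast intro: has_derivative_linear holo_has_derivative)

lemma holo_plus: "holo F F' \<Longrightarrow> F' M (X + Y) = F' M X + F' M Y"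
  using holo_linear[of F F' M] by (simp add: linear_add)

lemma holo_sum_arg: "holo F F' \<Longrightarrow> F' M (\<Sum>i\<in>S. f i) = (\<Sum>i\<in>S. F' M (f i))"
  using holo_linear[of F F' M] by (simp add: linear_sum)

lemma holo_const: "holo (\<lambda>_. c) (\<lambda>_ _. 0)"
  by (auto simp: holo_def)

lemma holo_entry: "holo (\<lambda>M. M $ i $ j) (\<lambda>M X. X $ i $ j)"
  unfolding holo_def
  by (auto intro!: continuous_intros bounded_linear.has_derivative[OF bounded_linear_vec_nth]
      bounded_linear_imp_has_derivative bounded_linear_compose[OF bounded_linear_vec_nth bounded_linear_vec_nth])

lemma holo_continuous_fst: "holo F F' \<Longrightarrow> continuous_on UNIV (\<lambda>p. F (fst p))"
  by (rule continuous_on_compose2[OF holo_continuous]) (auto intro: continuous_intros)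

lemma holoI:
  assumes "\<And>M. (F has_derivative F' M) (at M)" "\<And>M c X. F' M (cscale c X) = c * F' M X"
    "continuous_on UNIV (\<lambda>p. F' (fst p) (snd p))"
  shows "holo F F'"
  using assms by (simp add: holo_def)

lemma holo_add:
  assumes "holo F F'" "holo G G'"
  shows "holo (\<lambda>M. F M + G M) (\<lambda>M X. F' M X + G' M X)"
proof (rule holoI)
  show "((\<lambda>M. F M + G M) has_derivative (\<lambda>X. F' M X + G' M X)) (at M)" for M
    by (intro has_derivative_add holo_has_derivative assms)
  show "continuous_on UNIV (\<lambda>p. F' (fst p) (snd p) + G' (fst p) (snd p))"
    by (intro continuous_on_add holo_continuous'[OF assms(1)] holo_continuous'[OF assms(2)])
qed (simp add: holo_cscale[OF assms(1)] holo_cscale[OF assms(2)] ring_distribs)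

lemma holo_mult:
  assumes "holo F F'" "holo G G'"
  shows "holo (\<lambda>M. F M * G M) (\<lambda>M X. F M * G' M X + F' M X * G M)"
proof (rule holoI)
  show "((\<lambda>M. F M * G M) has_derivative (\<lambda>X. F M * G' M X + F' M X * G M)) (at M)" for M
    by (intro has_derivative_mult holo_has_derivative assms)
  show "continuous_on UNIV (\<lambda>p. F (fst p) * G' (fst p) (snd p) + F' (fst p) (snd p) * G (fst p))"
    by (intro continuous_on_add continuous_on_mult holo_continuous'[OF assms(1)] holo_continuous'[OF assms(2)]
        holo_continuous_fst[OF assms(1)] holo_continuous_fst[OF assms(2)])
qed (simp add: holo_cscale[OF assms(1)] holo_cscale[OF assms(2)] ring_distribs)

lemma holo_sum:
  assumes "\<And>i. i \<in> S \<Longrightarrow> holo (F i) (F' i)"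
  shows "holo (\<lambda>M. \<Sum>i\<in>S. F i M) (\<lambda>M X. \<Sum>i\<in>S. F' i M X)"
proof (rule holoI)
  show "((\<lambda>M. \<Sum>i\<in>S. F i M) has_derivative (\<lambda>X. \<Sum>i\<in>S. F' i M X)) (at M)" for M
    by (intro has_derivative_sum holo_has_derivative assms)
  show "continuous_on UNIV (\<lambda>p. \<Sum>i\<in>S. F' i (fst p) (snd p))"
    by (intro continuous_on_sum holo_continuous'[OF assms])
qed (simp add: holo_cscale[OF assms] sum_distrib_left)

lemma holo_prod:
  assumes "\<And>i. i \<in> S \<Longrightarrow> holo (F i) (F' i)"
  shows "holo (\<lambda>M. \<Prod>i\<in>S. F i M) (\<lambda>M X. \<Sum>i\<in>S. F' i M X * (\<Prod>j\<in>S - {i}. F j M))"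
proof (rule holoI)
  show "((\<lambda>M. \<Prod>i\<in>S. F i M) has_derivative (\<lambda>X. \<Sum>i\<in>S. F' i M X * (\<Prod>j\<in>S - {i}. F j M))) (at M)" for M
    by (intro has_derivative_prod holo_has_derivative assms)
  show "continuous_on UNIV (\<lambda>p. \<Sum>i\<in>S. F' i (fst p) (snd p) * (\<Prod>j\<in>S - {i}. F j (fst p)))"
    by (intro continuous_on_sum continuous_on_mult continuous_on_prod holo_continuous'[OF assms]
        holo_continuous_fst[OF assms]) auto
qed (simp add: holo_cscale[OF assms] sum_distrib_left mult.assoc)

lemma holo_cmult: "holo F F' \<Longrightarrow> holo (\<lambda>M. c * F M) (\<lambda>M X. c * F' M X)"
  using holo_mult[OF holo_const[of c]] by simp

text \<open>All functions in the proof are built from the matrix entries by sums and products, so that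
  their derivatives come from these closure properties.\<close>

lemma holo_det:
  assumes "\<And>i j. holo (\<lambda>M. A M $ i $ j) (\<lambda>M X. A' M X $ i $ j)"
  shows "holo (\<lambda>M. det (A M)) (\<lambda>M X. det_variation (A M) (A' M X))"
  unfolding Determinants.det_def det_variation_def
  by (intro holo_sum holo_cmult holo_prod assms)

lemma holo_fdet:
  assumes "\<And>i j. holo (\<lambda>M. a M i j) (\<lambda>M X. a' M X i j)"
  shows "holo (\<lambda>M. fdet n (a M)) (\<lambda>M X. fdet_variation n (a M) (a' M X))"
  unfolding fdet_eq fdet_variation_def
  by (intro holo_sum holo_cmult holo_prod assms)

lemma holo_power:
  assumes "holo F F'"
  shows "holo (\<lambda>M. F M ^ p) (\<lambda>M X. of_nat p * F' M X * F M ^ (p - 1))"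
proof (induction p)
  case (Suc p)
  have "F M * (of_nat p * F' M X * F M ^ (p - 1)) = of_nat p * F' M X * F M ^ p" for M X
    by (cases p) auto
  then have "F M * (of_nat p * F' M X * F M ^ (p - 1)) + F' M X * F M ^ p
      = of_nat (Suc p) * F' M X * F M ^ (Suc p - 1)" for M X
    by (simp add: ring_distribs)
  then show ?case
    using holo_mult[OF assms Suc] by simp
qed (simp add: holo_const)

primrec mpow_deriv :: "complex ^ 'n ^ 'n \<Rightarrow> nat \<Rightarrow> complex ^ 'n ^ 'n \<Rightarrow> complex ^ 'n ^ 'n" where
  "mpow_deriv M 0 X = 0"
| "mpow_deriv M (Suc k) X = X ** mpow M k + M ** mpow_deriv M k X"

lemma holo_mpow: "holo (\<lambda>M. mpow M k $ i $ j) (\<lambda>M X. mpow_deriv M k X $ i $ j)"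
proof (induction k arbitrary: i j)
  case 0
  show ?case using holo_const by simp
next
  case (Suc k)
  have "holo (\<lambda>M. \<Sum>m\<in>UNIV. M $ i $ m * mpow M k $ m $ j)
     (\<lambda>M X. \<Sum>m\<in>UNIV. M $ i $ m * mpow_deriv M k X $ m $ j + X $ i $ m * mpow M k $ m $ j)"
    by (intro holo_sum holo_mult holo_entry Suc)
  then show ?case
    by (simp add: matrix_matrix_mult_def sum.distrib add.commute)
qed

lemma holo_trace_mpow: "holo (\<lambda>M. trace (mpow M k)) (\<lambda>M X. trace (mpow_deriv M k X))"
  unfolding trace_def by (intro holo_sum holo_mpow)

lemma matrix_mul_cscale: "M ** cscale c X = cscale c (M ** X)"
  by (simp add: Finite_Cartesian_Product.vec_eq_iff matrix_matrix_mult_def sum_distrib_left mult_ac)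

lemma trace_cscale: "trace (cscale c X) = c * trace X"
  by (simp add: trace_def sum_distrib_left)

lemma mpow_add: "mpow M (j + k) = mpow M j ** mpow M k"
  by (induction j) (simp_all add: matrix_mul_assoc)

text \<open>In a direction that commutes with M the derivative of a power is the commutative one.\<close>

lemma mpow_deriv_mpow:
  "mpow_deriv M (Suc k) (mpow M b) = cscale (of_nat (Suc k)) (mpow M (k + b))"
proof (induction k)
  case 0
  show ?case by (simp add: Finite_Cartesian_Product.vec_eq_iff)
next
  case (Suc k)
  have "mpow_deriv M (Suc (Suc k)) (mpow M b)
      = mpow M (b + Suc k) + cscale (of_nat (Suc k)) (M ** mpow M (k + b))"
    unfolding mpow_deriv.simps(2)[of M "Suc k"] Suc mpow_add matrix_mul_cscale ..
  also have "M ** mpow M (k + b) = mpow M (b + Suc k)"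
    by (simp add: add.commute)
  finally show ?case
    by (simp add: Finite_Cartesian_Product.vec_eq_iff algebra_simps)
qed

lemma trace_mpow_deriv:
  "trace (mpow_deriv M (Suc k) (mpow M b)) = of_nat (Suc k) * trace (mpow M (k + b))"
  by (simp only: mpow_deriv_mpow trace_cscale)

lemma hom_series_0: "fps_nth (hom_series M) 0 = 1"
  by (simp add: hom_series_def rev_charpoly_0)

text \<open>Coefficients of H' = P H. Read as a recursion, this exhibits h_k as a polynomial in the
  traces tr(M^i), hence in the entries of M, although it was defined through the eigenvalues.\<close>

lemma newton_identity:
  "fps_nth (hom_series M) (Suc k)
   = (\<Sum>i\<le>k. trace (mpow M (Suc i)) * fps_nth (hom_series M) (k - i)) / of_nat (Suc k)"
proof -
  have "of_nat (Suc k) * fps_nth (hom_series M) (Suc k)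
      = (\<Sum>i\<le>k. trace (mpow M (Suc i)) * fps_nth (hom_series M) (k - i))"
    using arg_cong[OF fps_deriv_hom_series[of M], of "\<lambda>f. fps_nth f k"]
    by (simp add: fps_mult_nth power_sum_series_def atLeast0AtMost)
  then show ?thesis
    by (simp add: field_simps del: of_nat_Suc)
qed

text \<open>The derivative of h_k in the direction X, by differentiating the recursion of
  \<open>newton_identity\<close>.\<close>

fun hom_deriv :: "complex ^ 'n ^ 'n \<Rightarrow> complex ^ 'n ^ 'n \<Rightarrow> nat \<Rightarrow> complex" where
  "hom_deriv M X 0 = 0"
| "hom_deriv M X (Suc k) = (\<Sum>i\<le>k. trace (mpow M (Suc i)) * hom_deriv M X (k - i)
     + trace (mpow_deriv M (Suc i) X) * fps_nth (hom_series M) (k - i)) / of_nat (Suc k)"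

lemma holo_hom_series: "holo (\<lambda>M :: complex ^ 'n ^ 'n. fps_nth (hom_series M) k) (\<lambda>M X. hom_deriv M X k)"
proof (induction k rule: less_induct)
  case (less k)
  show ?case
  proof (cases k)
    case 0
    then show ?thesis by (simp add: hom_series_0 holo_const)
  next
    case (Suc m)
    have IH: "holo (\<lambda>M :: complex ^ 'n ^ 'n. fps_nth (hom_series M) (m - i)) (\<lambda>M X. hom_deriv M X (m - i))" for i
      using less.IH[of "m - i"] Suc by (simp add: less_Suc_eq_le del: hom_deriv.simps)
    have "holo (\<lambda>M :: complex ^ 'n ^ 'n. inverse (of_nat (Suc m)) * (\<Sum>i\<le>m. trace (mpow M (Suc i)) * fps_nth (hom_series M) (m - i)))
      (\<lambda>M X. inverse (of_nat (Suc m)) * (\<Sum>i\<le>m. trace (mpow M (Suc i)) * hom_deriv M X (m - i)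
        + trace (mpow_deriv M (Suc i) X) * fps_nth (hom_series M) (m - i)))"
      by (intro holo_sum holo_cmult holo_mult holo_trace_mpow IH)
    then show ?thesis
      unfolding Suc newton_identity hom_deriv.simps divide_inverse by (simp only: mult.commute)
  qed
qed

lemma fps_linear_ode_unique:
  fixes Y Z :: "complex fps"
  assumes "fps_deriv Y = Q + P * Y" "fps_deriv Z = Q + P * Z" "fps_nth Y 0 = fps_nth Z 0"
  shows "Y = Z"
proof (rule fps_ext)
  fix k
  show "fps_nth Y k = fps_nth Z k"
  proof (induction k rule: less_induct)
    case (less k)
    show ?case
    proof (cases k)
      case 0
      then show ?thesis using assms by simp
    next
      case (Suc m)
      have "of_nat (Suc m) * fps_nth Y (Suc m) = fps_nth (Q + P * Y) m"
        using arg_cong[OF assms(1), of "\<lambda>f. fps_nth f m"] by simp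
      also have "fps_nth (Q + P * Y) m = fps_nth (Q + P * Z) m"
        using less Suc by (simp add: fps_mult_nth)
      also have "\<dots> = of_nat (Suc m) * fps_nth Z (Suc m)"
        using arg_cong[OF assms(2), of "\<lambda>f. fps_nth f m"] by simp
      finally show ?thesis
        using Suc by (simp del: of_nat_Suc)
    qed
  qed
qed

text \<open>Differentiating H' = P H along X gives a linear equation Y' = Q H + P Y for the series Y of
  derivatives, so that a closed formula for Y only has to be checked against this equation.\<close>

lemma hom_deriv_series:
  assumes "fps_deriv Y = Abs_fps (\<lambda>k. trace (mpow_deriv M (Suc k) X)) * hom_series M + power_sum_series M * Y"
    and "fps_nth Y 0 = 0"
  shows "hom_deriv M X k = fps_nth Y k"
proof -
  have "fps_deriv (Abs_fps (hom_deriv M X))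
      = Abs_fps (\<lambda>k. trace (mpow_deriv M (Suc k) X)) * hom_series M + power_sum_series M * Abs_fps (hom_deriv M X)"
    by (rule fps_ext)
      (simp add: fps_mult_nth power_sum_series_def atLeast0AtMost sum.distrib add.commute del: of_nat_Suc mpow.simps mpow_deriv.simps)
  from this assms(1) have "Abs_fps (hom_deriv M X) = Y"
    by (rule fps_linear_ode_unique) (simp add: assms(2))
  then show ?thesis by auto
qed

lemma hom_series_deriv2:
  "fps_deriv (fps_deriv (hom_series M))
   = fps_deriv (power_sum_series M) * hom_series M + power_sum_series M * power_sum_series M * hom_series M"
  by (simp add: fps_deriv_hom_series algebra_simps)

text \<open>Y = t H': the scaling M to sM amounts to t to st.\<close>

lemma hom_deriv_self: "hom_deriv M M k = of_nat k * fps_nth (hom_series M) k"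
proof -
  have P: "Abs_fps (\<lambda>k. trace (mpow_deriv M (Suc k) M)) = fps_deriv (fps_X * power_sum_series M)"
  proof (rule fps_ext)
    fix k
    show "fps_nth (Abs_fps (\<lambda>k. trace (mpow_deriv M (Suc k) M))) k
        = fps_nth (fps_deriv (fps_X * power_sum_series M)) k"
      using trace_mpow_deriv[of M k 1]
      by (simp add: power_sum_series_def del: mpow_deriv.simps fps_deriv_mult)
  qed
  have "hom_deriv M M k = fps_nth (fps_X * fps_deriv (hom_series M)) k"
    by (rule hom_deriv_series, unfold P fps_deriv_mult fps_deriv_fps_X hom_series_deriv2
        fps_deriv_hom_series) (simp_all add: algebra_simps)
  then show ?thesis by (cases k) simp_all
qed

text \<open>Y = n t H + t^2 H', the derivative of prod 1 / (1 - u_i t) under a common translation of the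
  eigenvalues u_i.\<close>

lemma hom_deriv_1:
  fixes M :: "complex ^ 'n ^ 'n"
  shows "hom_deriv M (mat 1) k
    = (if k = 0 then 0 else of_nat (CARD('n) + k - 1) * fps_nth (hom_series M) (k - 1))"
proof -
  let ?n = "fps_const (of_nat CARD('n)) :: complex fps"
  have P: "Abs_fps (\<lambda>k. trace (mpow_deriv M (Suc k) (mat 1)))
      = fps_deriv (fps_X * (?n + fps_X * power_sum_series M))"
  proof (rule fps_ext)
    fix k
    show "fps_nth (Abs_fps (\<lambda>k. trace (mpow_deriv M (Suc k) (mat 1)))) k
      = fps_nth (fps_deriv (fps_X * (?n + fps_X * power_sum_series M))) k"
      using trace_mpow_deriv[of M k 0]
      by (cases k) (simp_all add: power_sum_series_def trace_I del: mpow_deriv.simps fps_deriv_mult)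
  qed
  have "hom_deriv M (mat 1) k
      = fps_nth (fps_X * (?n * hom_series M + fps_X * fps_deriv (hom_series M))) k"
    by (rule hom_deriv_series, unfold P fps_deriv_mult fps_deriv_add fps_deriv_fps_X
        fps_deriv_const hom_series_deriv2 fps_deriv_hom_series) (simp_all add: algebra_simps)
  then show ?thesis
  proof (cases k)
    case (Suc m)
    with \<open>hom_deriv M (mat 1) k = _\<close> show ?thesis
      by (cases m) (simp_all add: algebra_simps)
  qed simp
qed

text \<open>Y = H' - tr(M) H, from u_i^2 t / (1 - u_i t) = u_i / (1 - u_i t) - u_i for every eigenvalue
  u_i.\<close>

lemma hom_deriv_square:
  "hom_deriv M (M ** M) k
    = of_nat (Suc k) * fps_nth (hom_series M) (Suc k) - trace M * fps_nth (hom_series M) k"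
proof -
  have P: "Abs_fps (\<lambda>k. trace (mpow_deriv M (Suc k) (M ** M))) = fps_deriv (power_sum_series M)"
  proof (rule fps_ext)
    fix k
    show "fps_nth (Abs_fps (\<lambda>k. trace (mpow_deriv M (Suc k) (M ** M)))) k
        = fps_nth (fps_deriv (power_sum_series M)) k"
      using trace_mpow_deriv[of M k 2]
      by (simp add: power_sum_series_def numeral_2_eq_2 del: mpow_deriv.simps)
  qed
  have "hom_deriv M (M ** M) k
      = fps_nth (fps_deriv (hom_series M) - fps_const (trace M) * hom_series M) k"
  proof (rule hom_deriv_series)
    show "fps_deriv (fps_deriv (hom_series M) - fps_const (trace M) * hom_series M)
      = Abs_fps (\<lambda>k. trace (mpow_deriv M (Suc k) (M ** M))) * hom_series M
        + power_sum_series M * (fps_deriv (hom_series M) - fps_const (trace M) * hom_series M)"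
      unfolding P fps_deriv_sub fps_deriv_mult fps_deriv_const hom_series_deriv2 fps_deriv_hom_series
      by (simp add: algebra_simps)
    show "fps_nth (fps_deriv (hom_series M) - fps_const (trace M) * hom_series M) 0 = 0"
      by (simp add: fps_deriv_hom_series power_sum_series_def hom_series_0 del: fps_deriv_nth)
  qed
  then show ?thesis by simp
qed

section \<open>Schur functions along the directions 1, M and M^2\<close>

abbreviation hsym :: "complex ^ 'n ^ 'n \<Rightarrow> int \<Rightarrow> complex" where
  "hsym M k \<equiv> complete_homogeneous k (eigenvalues M)"

definition hsym_deriv :: "complex ^ 'n ^ 'n \<Rightarrow> complex ^ 'n ^ 'n \<Rightarrow> int \<Rightarrow> complex" where
  "hsym_deriv M X k = (if k < 0 then 0 else hom_deriv M X (nat k))"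

lemma holo_hsym: "holo (\<lambda>M. hsym M k) (\<lambda>M X. hsym_deriv M X k)"
  by (cases "k < 0")
    (simp_all add: complete_homogeneous_eigenvalues hsym_deriv_def holo_const holo_hom_series)

lemma hsym_deriv_self: "hsym_deriv M M k = of_int k * hsym M k"
  by (simp add: complete_homogeneous_eigenvalues hsym_deriv_def hom_deriv_self)

lemma hsym_deriv_1:
  fixes M :: "complex ^ 'n ^ 'n"
  shows "hsym_deriv M (mat 1) k = of_int (int CARD('n) + k - 1) * hsym M (k - 1)"
proof (cases "k \<le> 0")
  case True
  then show ?thesis
    by (auto simp: complete_homogeneous_eigenvalues hsym_deriv_def hom_deriv_1)
next
  case False
  have "int (CARD('n) + nat k - 1) = int CARD('n) + k - 1"
    using False by simp
  then have "(of_nat (CARD('n) + nat k - 1) :: complex) = of_int (int CARD('n) + k - 1)"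
    by (metis of_int_of_nat_eq)
  moreover have "nat (k - 1) = nat k - 1"
    using False by simp
  ultimately show ?thesis
    using False
    by (simp add: complete_homogeneous_eigenvalues hsym_deriv_def hom_deriv_1 del: of_nat_diff of_nat_add of_int_add of_int_diff)
qed

lemma hsym_deriv_square:
  "hsym_deriv M (M ** M) k = of_int (k + 1) * hsym M (k + 1) - trace M * hsym M k"
proof (cases "k < 0")
  case True
  then show ?thesis
    by (cases "k = -1") (auto simp: complete_homogeneous_eigenvalues hsym_deriv_def)
next
  case False
  then have "nat (k + 1) = Suc (nat k)" by simp
  then show ?thesis
    using False by (simp add: complete_homogeneous_eigenvalues hsym_deriv_def hom_deriv_square)
qed

text \<open>The coefficients of H det(1 - tM) = 1. Since det(1 - tM) has degree at most n, any h_k is a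
  combination of its n predecessors.\<close>

lemma hsym_recurrence:
  fixes M :: "complex ^ 'n ^ 'n"
  assumes "k \<ge> 1"
  shows "hsym M k = (\<Sum>c=1..CARD('n). - coeff (rev_charpoly M) c * hsym M (k - int c))"
proof -
  define m where "m = nat k"
  have m: "k = int m" "m > 0" using assms by (auto simp: m_def)
  let ?f = "\<lambda>c. coeff (rev_charpoly M) c * hsym M (int m - int c)"
  have "fps_of_poly (rev_charpoly M) * hom_series M = 1"
    unfolding hom_series_def by (rule inverse_mult_eq_1') (simp add: rev_charpoly_0)
  then have "0 = fps_nth (fps_of_poly (rev_charpoly M) * hom_series M) m"
    using m by simp
  also have "\<dots> = (\<Sum>c=0..m. ?f c)"
    unfolding fps_mult_nth
    by (intro sum.cong) (auto simp: complete_homogeneous_eigenvalues nat_diff_distrib)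
  also have "\<dots> = (\<Sum>c=0..max m CARD('n). ?f c)"
    by (rule sum.mono_neutral_left) (auto simp: complete_homogeneous_eigenvalues)
  also have "\<dots> = (\<Sum>c=0..CARD('n). ?f c)"
    using degree_rev_charpoly[of M]
    by (intro sum.mono_neutral_right) (auto simp: coeff_eq_0)
  also have "\<dots> = hsym M k + (\<Sum>c=1..CARD('n). ?f c)"
    by (subst sum.atLeast_Suc_atMost) (simp_all add: rev_charpoly_0 m)
  finally show ?thesis
    by (simp add: sum_negf m eq_neg_iff_add_eq_0)
qed

lemma coeff_rev_charpoly_1:
  fixes M :: "complex ^ 'n ^ 'n"
  shows "coeff (rev_charpoly M) 1 = - trace M"
proof -
  have "hsym M 1 = (\<Sum>c=1..CARD('n). if c = 1 then - coeff (rev_charpoly M) 1 else 0)"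
    unfolding hsym_recurrence[of 1 M, simplified]
    by (intro sum.cong) (auto simp: complete_homogeneous_eigenvalues hom_series_0)
  moreover have "hsym M 1 = trace M"
    using newton_identity[of M 0] by (simp add: complete_homogeneous_eigenvalues hom_series_0)
  ultimately show ?thesis
    by (simp add: Suc_le_eq)
qed

definition schur_deriv ::
  "(nat \<Rightarrow> int) \<Rightarrow> complex ^ 'n ^ 'n \<Rightarrow> complex ^ 'n ^ 'n \<Rightarrow> complex" where
  "schur_deriv l M X = fdet_variation CARD('n)
     (\<lambda>i j. hsym M (l (i + 1) - int i + int j)) (\<lambda>i j. hsym_deriv M X (l (i + 1) - int i + int j))"

lemma schur_mat_eq:
  fixes M :: "complex ^ 'n ^ 'n"
  shows "schur_mat l M = fdet CARD('n) (\<lambda>i j. hsym M (l (i + 1) - int i + int j))"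
  by (simp add: schur_mat_def schur_def)

lemma holo_schur:
  "holo (schur_mat l :: complex ^ 'n ^ 'n \<Rightarrow> complex) (schur_deriv l)"
proof -
  have "schur_mat l = (\<lambda>M :: complex ^ 'n ^ 'n. fdet CARD('n) (\<lambda>i j. hsym M (l (i + 1) - int i + int j)))"
    by (simp add: schur_mat_eq fun_eq_iff)
  moreover have "schur_deriv l = (\<lambda>M X :: complex ^ 'n ^ 'n. fdet_variation CARD('n)
     (\<lambda>i j. hsym M (l (i + 1) - int i + int j)) (\<lambda>i j. hsym_deriv M X (l (i + 1) - int i + int j)))"
    by (simp add: schur_deriv_def fun_eq_iff)
  ultimately show ?thesis
    by (simp only:) (intro holo_fdet holo_hsym)
qed

lemma fdet_variation_row_weights:
  "fdet_variation n a (\<lambda>i j. w i * b i j) = (\<Sum>i=0..<n. w i * fdet n (a(i := b i)))"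
  unfolding fdet_variation_rows by (intro sum.cong refl, rule fdet_row_mult) simp

lemma fdet_variation_self: "fdet_variation n a a = of_nat n * fdet n a"
  by (simp add: fdet_variation_rows)

lemma fdet_variation_col_weights:
  "fdet_variation n a (\<lambda>i j. v j * b i j) = (\<Sum>c=0..<n. v c * fdet n (\<lambda>i j. if j = c then b i j else a i j))"
  unfolding fdet_variation_cols
proof (rule sum.cong[OF refl])
  fix c assume "c \<in> {0..<n}"
  then show "fdet n (\<lambda>i j. if j = c then v j * b i j else a i j)
      = v c * fdet n (\<lambda>i j. if j = c then b i j else a i j)"
    using fdet_col_sum[of c n "{()}" "\<lambda>_. v c" "\<lambda>_ i. b i c" a]
    by (simp cong: if_cong)
qed

text \<open>A column equal to its right neighbour makes the determinant vanish, so only the last column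
  contributes.\<close>

lemma fdet_variation_next_col:
  assumes "n > 0"
  shows "fdet_variation n a (\<lambda>i j. v j * a i (j + 1))
    = v (n - 1) * fdet n (\<lambda>i j. if j = n - 1 then a i n else a i j)"
proof -
  have "(\<lambda>i j. if j = n - 1 then a i (j + 1) else a i j) = (\<lambda>i j. if j = n - 1 then a i n else a i j)"
    using assms by (simp add: fun_eq_iff)
  moreover have "fdet n (\<lambda>i j. if j = c then a i (j + 1) else a i j) = 0" if "c < n - 1" for c
    using that by (intro fdet_identical_cols[of c n "c + 1"]) auto
  ultimately have "fdet_variation n a (\<lambda>i j. v j * a i (j + 1))
    = (\<Sum>c=0..<n. if c = n - 1 then v (n - 1) * fdet n (\<lambda>i j. if j = n - 1 then a i n else a i j) else 0)"
    unfolding fdet_variation_col_weights by (intro sum.cong) auto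
  also have "\<dots> = v (n - 1) * fdet n (\<lambda>i j. if j = n - 1 then a i n else a i j)"
    using assms by simp
  finally show ?thesis .
qed

text \<open>A column equal to its left neighbour makes the determinant vanish, and the first column has
  weight zero.\<close>

lemma fdet_variation_previous_col:
  fixes a b :: "nat \<Rightarrow> nat \<Rightarrow> 'a::comm_ring_1"
  assumes "\<And>i j. j > 0 \<Longrightarrow> b i j = a i (j - 1)"
  shows "fdet_variation n a (\<lambda>i j. of_nat j * b i j) = 0"
proof -
  have "of_nat c * fdet n (\<lambda>i j. if j = c then b i j else a i j) = 0" if "c < n" for c
  proof (cases "c = 0")
    case False
    then have "fdet n (\<lambda>i j. if j = c then b i j else a i j) = 0"
      using that assms by (intro fdet_identical_cols[of c n "c - 1"]) auto
    then show ?thesis by simp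
  qed simp
  then show ?thesis
    unfolding fdet_variation_col_weights by simp
qed

lemma schur_mat_add_unit:
  fixes M :: "complex ^ 'n ^ 'n"
  shows "schur_mat (l \<oplus>e Suc i) M
    = fdet CARD('n) ((\<lambda>i j. hsym M (l (i + 1) - int i + int j))(i := \<lambda>j. hsym M (l (i + 1) - int i + int j + 1)))"
  unfolding schur_mat_eq
  by (rule arg_cong[of _ _ "fdet _"]) (auto simp: add_unit_def fun_eq_iff algebra_simps)

lemma schur_mat_sub_unit:
  fixes M :: "complex ^ 'n ^ 'n"
  shows "schur_mat (l \<ominus>e Suc i) M
    = fdet CARD('n) ((\<lambda>i j. hsym M (l (i + 1) - int i + int j))(i := \<lambda>j. hsym M (l (i + 1) - int i + int j - 1)))"
  unfolding schur_mat_eq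
  by (rule arg_cong[of _ _ "fdet _"]) (auto simp: sub_unit_def fun_eq_iff algebra_simps)

lemma sum_1_n: "(\<Sum>i=1..n. f i) = (\<Sum>i=0..<n. f (Suc i))"
  by (simp add: sum.atLeast1_atMost_eq atLeast0LessThan)

text \<open>The derivative of an entry h_k is (n + k - 1) h_(k-1), and n + k - 1 splits into l_i - i +
  n, which depends on the row only, and the column index. The row part gives the right-hand
  side and the column part vanishes.\<close>

lemma schur_deriv_1:
  fixes M :: "complex ^ 'n ^ 'n"
  shows "schur_deriv l M (mat 1)
    = (\<Sum>i=1..CARD('n). of_int (l i - int i + int CARD('n)) * schur_mat (l \<ominus>e i) M)"
proof -
  define a where "a = (\<lambda>i j. hsym M (l (i + 1) - int i + int j))"
  define b where "b = (\<lambda>i j. hsym M (l (i + 1) - int i + int j - 1))"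
  let ?w = "\<lambda>i. of_int (l (Suc i) - int (Suc i) + int CARD('n))"
  have "schur_deriv l M (mat 1) = fdet_variation CARD('n) a (\<lambda>i j. ?w i * b i j + of_nat j * b i j)"
    unfolding schur_deriv_def hsym_deriv_1 a_def b_def by (simp add: algebra_simps)
  also have "fdet_variation CARD('n) a (\<lambda>i j. of_nat j * b i j) = 0"
    by (rule fdet_variation_previous_col) (auto simp: a_def b_def of_nat_diff algebra_simps)
  then have "fdet_variation CARD('n) a (\<lambda>i j. ?w i * b i j + of_nat j * b i j)
      = (\<Sum>i=0..<CARD('n). ?w i * fdet CARD('n) (a(i := b i)))"
    unfolding fdet_variation_add fdet_variation_row_weights[of _ _ ?w b] by (simp del: fun_upd_apply)
  finally show ?thesis
    unfolding sum_1_n schur_mat_sub_unit a_def b_def .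
qed

text \<open>The derivative of an entry h_k is k h_k. The row and column parts of k contribute |l| -
  n(n-1)/2 and n(n-1)/2.\<close>

lemma schur_deriv_self:
  fixes M :: "complex ^ 'n ^ 'n"
  shows "schur_deriv l M M = of_int (\<Sum>i=1..CARD('n). l i) * schur_mat l M"
proof -
  define a where "a = (\<lambda>i j. hsym M (l (i + 1) - int i + int j))"
  let ?w = "\<lambda>i. of_int (l (Suc i) - int i)"
  have S: "schur_mat l M = fdet CARD('n) a"
    unfolding schur_mat_eq a_def ..
  have "schur_deriv l M M = fdet_variation CARD('n) a (\<lambda>i j. ?w i * a i j + of_nat j * a i j)"
    unfolding schur_deriv_def hsym_deriv_self a_def by (simp add: algebra_simps)
  also have "\<dots> = (\<Sum>i=0..<CARD('n). ?w i) * schur_mat l M + (\<Sum>i=0..<CARD('n). of_nat i) * schur_mat l M"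
    unfolding fdet_variation_add fdet_variation_row_weights[of _ a ?w a]
      fdet_variation_col_weights[of _ a of_nat a] S
    by (simp add: sum_distrib_right)
  also have "\<dots> = of_int (\<Sum>i=1..CARD('n). l i) * schur_mat l M"
    unfolding sum_1_n by (simp add: sum_subtractf algebra_simps)
  finally show ?thesis .
qed

text \<open>Only the last column is moved up by one. By the recurrence for the h_k the new column is a
  combination of the n old ones. All but the old last column occur in the matrix already and
  contribute nothing; the old last column has coefficient tr M. The recurrence needs h indices
  of at least 1, whence the assumption.\<close>

lemma pieri_aux:
  fixes M :: "complex ^ 'n ^ 'n"
  assumes "\<And>i. i \<in> {1..CARD('n)} \<Longrightarrow> l i - int i + int CARD('n) \<ge> 0"
  shows "fdet CARD('n) (\<lambda>i j. if j = CARD('n) - 1 then hsym M (l (i + 1) - int i + int CARD('n))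
      else hsym M (l (i + 1) - int i + int j)) = trace M * schur_mat l M"
proof -
  let ?n = "CARD('n)"
  let ?a = "\<lambda>i j. hsym M (l (i + 1) - int i + int j)"
  let ?e = "\<lambda>c. - coeff (rev_charpoly M) c"
  have "fdet ?n (\<lambda>i j. if j = ?n - 1 then hsym M (l (i + 1) - int i + int ?n) else ?a i j)
    = fdet ?n (\<lambda>i j. if j = ?n - 1 then (\<Sum>c=1..?n. ?e c * hsym M (l (i + 1) - int i + int ?n - int c)) else ?a i j)"
    (is "fdet _ ?l = fdet _ ?r")
  proof -
    have "?l i j = ?r i j" if "i < ?n" for i j
      using assms[of "i + 1"] that by (simp add: hsym_recurrence)
    then show ?thesis
      by (intro arg_cong[of _ _ Determinant.det] cong_mat) auto
  qed
  also have "\<dots> = (\<Sum>c=1..?n. ?e c * fdet ?n (\<lambda>i j. if j = ?n - 1 then hsym M (l (i + 1) - int i + int ?n - int c) else ?a i j))"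
    by (rule fdet_col_sum) auto
  also have "\<dots> = (\<Sum>c=1..?n. if c = 1 then trace M * schur_mat l M else 0)"
  proof (rule sum.cong[OF refl])
    fix c assume c: "c \<in> {1..?n}"
    show "?e c * fdet ?n (\<lambda>i j. if j = ?n - 1 then hsym M (l (i + 1) - int i + int ?n - int c) else ?a i j)
      = (if c = 1 then trace M * schur_mat l M else 0)"
    proof (cases "c = 1")
      case True
      have "(\<lambda>i j. if j = ?n - 1 then hsym M (l (i + 1) - int i + int ?n - int c) else ?a i j) = ?a"
        using True by (auto simp: fun_eq_iff of_nat_diff Suc_le_eq algebra_simps)
      then show ?thesis
        using True coeff_rev_charpoly_1[of M] by (simp add: schur_mat_eq)
    next
      case False
      then have "fdet ?n (\<lambda>i j. if j = ?n - 1 then hsym M (l (i + 1) - int i + int ?n - int c) else ?a i j) = 0"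
        using c by (intro fdet_identical_cols[of "?n - 1" ?n "?n - c"]) (auto simp: of_nat_diff algebra_simps)
      then show ?thesis
        using False by simp
    qed
  qed
  finally show ?thesis
    by (simp add: Suc_le_eq)
qed

text \<open>Shifting the rows one at a time or the columns one at a time gives the same sum, and of the
  column shifts only the one of \<open>pieri_aux\<close> is nonzero.\<close>

lemma pieri:
  fixes M :: "complex ^ 'n ^ 'n"
  assumes "\<And>i. i \<in> {1..CARD('n)} \<Longrightarrow> l i - int i + int CARD('n) \<ge> 0"
  shows "(\<Sum>i=1..CARD('n). schur_mat (l \<oplus>e i) M) = trace M * schur_mat l M"
proof -
  define a where "a = (\<lambda>i j. hsym M (l (i + 1) - int i + int j))"
  have P: "fdet CARD('n) (\<lambda>i j. if j = CARD('n) - 1 then a i CARD('n) else a i j) = trace M * schur_mat l M"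
    unfolding a_def by (rule pieri_aux[OF assms])
  have n: "CARD('n) > 0" by simp
  have "fdet_variation CARD('n) a (\<lambda>i j. 1 * a i (j + 1))
      = (\<Sum>i=0..<CARD('n). 1 * fdet CARD('n) (a(i := \<lambda>j. a i (j + 1))))"
    by (rule fdet_variation_row_weights)
  moreover have "fdet_variation CARD('n) a (\<lambda>i j. 1 * a i (j + 1)) = trace M * schur_mat l M"
    by (subst fdet_variation_next_col[OF n, of a "\<lambda>_. 1"]) (simp only: P mult_1)
  moreover have "schur_mat (l \<oplus>e Suc i) M = fdet CARD('n) (a(i := \<lambda>j. a i (j + 1)))" for i
    unfolding schur_mat_add_unit a_def by (simp add: algebra_simps del: fun_upd_apply)
  ultimately show ?thesis
    unfolding sum_1_n by (simp del: fun_upd_apply)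
qed

text \<open>The entries contribute (k + 1) h_(k+1) - tr(M) h_k. Splitting k + 1 into row and column
  parts, the columns leave a single term, equal to tr(M) times the Schur function by
  \<open>pieri_aux\<close>, against n such terms with a minus sign.\<close>

lemma schur_deriv_square:
  fixes M :: "complex ^ 'n ^ 'n"
  assumes "\<And>i. i \<in> {1..CARD('n)} \<Longrightarrow> l i - int i + int CARD('n) \<ge> 0"
  shows "schur_deriv l M (M ** M)
    = (\<Sum>i=1..CARD('n). of_int (l i - int i + int CARD('n)) * schur_mat (l \<oplus>e i) M)
      - of_int (int CARD('n) - 1) * trace M * schur_mat l M"
proof -
  define a where "a = (\<lambda>i j. hsym M (l (i + 1) - int i + int j))"
  let ?w = "\<lambda>i. of_int (l (Suc i) - int (Suc i) + int CARD('n))"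
  let ?v = "\<lambda>j. of_int (int j + 2 - int CARD('n))"
  have S: "schur_mat l M = fdet CARD('n) a"
    unfolding schur_mat_eq a_def ..
  have P: "fdet CARD('n) (\<lambda>i j. if j = CARD('n) - 1 then a i CARD('n) else a i j) = trace M * schur_mat l M"
    unfolding a_def by (rule pieri_aux[OF assms])
  have n: "CARD('n) > 0" by simp
  have "schur_deriv l M (M ** M) = fdet_variation CARD('n) a
      (\<lambda>i j. (?w i * a i (j + 1) + ?v j * a i (j + 1)) + (- trace M) * a i j)"
    unfolding schur_deriv_def hsym_deriv_square a_def by (simp add: algebra_simps)
  also have "\<dots> = (\<Sum>i=0..<CARD('n). ?w i * fdet CARD('n) (a(i := \<lambda>j. a i (j + 1))))
      + ?v (CARD('n) - 1) * (trace M * schur_mat l M) + (- trace M) * (of_nat CARD('n) * schur_mat l M)"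
    unfolding fdet_variation_add fdet_variation_row_weights[of _ a ?w "\<lambda>i j. a i (j + 1)"]
      fdet_variation_cmult[of _ a "- trace M" a] fdet_variation_self
      fdet_variation_next_col[OF n, of a ?v] P S ..
  also have "?v (CARD('n) - 1) = (1 :: complex)"
    by (simp add: of_nat_diff Suc_le_eq)
  finally have "schur_deriv l M (M ** M)
      = (\<Sum>i=0..<CARD('n). ?w i * fdet CARD('n) (a(i := \<lambda>j. a i (j + 1))))
        - of_int (int CARD('n) - 1) * trace M * schur_mat l M"
    by (simp add: algebra_simps del: fun_upd_apply)
  moreover have "schur_mat (l \<oplus>e Suc i) M = fdet CARD('n) (a(i := \<lambda>j. a i (j + 1)))" for i
    unfolding schur_mat_add_unit a_def by (simp add: algebra_simps del: fun_upd_apply)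
  ultimately show ?thesis
    unfolding sum_1_n by (simp del: fun_upd_apply)
qed

lemma schur_mat_eq_0:
  fixes M :: "complex ^ 'n ^ 'n"
  assumes "i \<in> {1..<CARD('n)}" "l (i + 1) = l i + 1"
  shows "schur_mat l M = 0"
  unfolding schur_mat_eq
  by (rule fdet_identical_rows[of "i - 1" _ i]) (use assms in \<open>auto simp: of_nat_diff algebra_simps\<close>)

lemma schur_mat_add_unit_eq_0:
  fixes M :: "complex ^ 'n ^ 'n"
  assumes "is_partition CARD('n) l" "\<not> is_partition CARD('n) (l \<oplus>e i)"
  shows "schur_mat (l \<oplus>e i) M = 0"
proof -
  have nonneg: "0 \<le> l k" if "k \<in> {1..CARD('n)}" for k
    using assms(1) that unfolding is_partition_def by blast
  have decr: "l (k + 1) \<le> l k" if "k \<in> {1..<CARD('n)}" for k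
    using assms(1) that unfolding is_partition_def by blast
  have "0 \<le> (l \<oplus>e i) k" if "k \<in> {1..CARD('n)}" for k
    using nonneg[OF that] by (auto simp: add_unit_def)
  with assms(2) obtain j where j: "j \<in> {1..<CARD('n)}" "(l \<oplus>e i) j < (l \<oplus>e i) (j + 1)"
    unfolding is_partition_def by (meson not_le)
  then show ?thesis
    using decr[OF j(1)]
    by (intro schur_mat_eq_0[of j]) (simp_all add: add_unit_def split: if_splits)
qed

text \<open>Either two rows of the Jacobi-Trudi matrix coincide, or i = n and l_n = 0, where the weight
  l_i - i + n vanishes.\<close>

lemma schur_mat_sub_unit_eq_0:
  fixes M :: "complex ^ 'n ^ 'n"
  assumes "is_partition CARD('n) l" "\<not> is_partition CARD('n) (l \<ominus>e i)" "i \<in> {1..CARD('n)}"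
  shows "of_int (l i - int i + int CARD('n)) * schur_mat (l \<ominus>e i) M = 0"
proof (rule ccontr)
  assume *: "\<not> ?thesis"
  have nonneg: "0 \<le> l k" if "k \<in> {1..CARD('n)}" for k
    using assms(1) that unfolding is_partition_def by blast
  have decr: "l (k + 1) \<le> l k" if "k \<in> {1..<CARD('n)}" for k
    using assms(1) that unfolding is_partition_def by blast
  have ne: "l (i + 1) < l i" if "i \<in> {1..<CARD('n)}"
  proof (rule ccontr)
    assume "\<not> l (i + 1) < l i"
    then have "schur_mat (l \<ominus>e i) M = 0"
      using decr[OF that] that by (intro schur_mat_eq_0[of i]) (simp_all add: sub_unit_def)
    with * show False by simp
  qed
  have pos: "0 < l i"
  proof (cases "i = CARD('n)")
    case True
    then show ?thesis
      using * nonneg[OF assms(3)] by (cases "l i = 0") simp_all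
  next
    case False
    then have "i \<in> {1..<CARD('n)}" "i + 1 \<in> {1..CARD('n)}" using assms(3) by auto
    then show ?thesis
      using ne nonneg[of "i + 1"] by simp
  qed
  have "0 \<le> (l \<ominus>e i) k" if "k \<in> {1..CARD('n)}" for k
    using nonneg[OF that] pos by (simp add: sub_unit_def)
  moreover have "(l \<ominus>e i) (k + 1) \<le> (l \<ominus>e i) k" if "k \<in> {1..<CARD('n)}" for k
    using decr[OF that] ne that by (cases "k = i") (auto simp: sub_unit_def)
  ultimately have "is_partition CARD('n) (l \<ominus>e i)"
    unfolding is_partition_def by simp
  with assms(2) show False by simp
qed

section \<open>Integration by parts for Haar measure\<close>

abbreviation adj :: "complex ^ 'n ^ 'n \<Rightarrow> complex ^ 'n ^ 'n" where
  "adj M \<equiv> map_matrix cnj (transpose M)"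

lemma adj_mult: "adj (A ** B) = adj B ** adj A"
  by (simp add: Finite_Cartesian_Product.vec_eq_iff matrix_matrix_mult_def transpose_def mult.commute)

lemma adj_adj: "adj (adj A) = A"
  by (simp add: Finite_Cartesian_Product.vec_eq_iff transpose_def)

lemma matrix_add_distrib_right: "(A + B) ** C = A ** C + B ** C" for A B C :: "'a::comm_ring_1 ^ 'n ^ 'n"
  by (simp add: Finite_Cartesian_Product.vec_eq_iff matrix_matrix_mult_def ring_distribs sum.distrib)

lemma unitary_mult: "A \<in> unitary_group \<Longrightarrow> B \<in> unitary_group \<Longrightarrow> A ** B \<in> unitary_group"
proof -
  assume "A \<in> unitary_group" "B \<in> unitary_group"
  then have A: "adj A ** A = mat 1" and B: "adj B ** B = mat 1"
    by (auto simp: unitary_group_def)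
  have "adj (A ** B) ** (A ** B) = adj B ** (adj A ** A) ** B"
    by (simp only: adj_mult matrix_mul_assoc)
  then show ?thesis by (simp add: A B unitary_group_def)
qed

lemma unitary_adj:
  assumes "A \<in> unitary_group"
  shows "adj A \<in> unitary_group" "A ** adj A = mat 1" "adj A ** A = mat 1"
  using assms by (auto simp: unitary_group_def adj_adj matrix_left_right_inverse)

lemma continuous_on_matrix_mult [continuous_intros]:
  fixes A B :: "'a::topological_space \<Rightarrow> complex ^ 'n ^ 'n"
  assumes "continuous_on S A" "continuous_on S B"
  shows "continuous_on S (\<lambda>x. A x ** B x)"
  unfolding matrix_matrix_mult_def
  by (intro continuous_on_vec_lambda continuous_on_sum continuous_on_mult continuous_on_component assms)

lemma continuous_on_adj [continuous_intros]:
  fixes A :: "'a::topological_space \<Rightarrow> complex ^ 'n ^ 'n"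
  assumes "continuous_on S A"
  shows "continuous_on S (\<lambda>x. adj (A x))"
  unfolding map_matrix_def transpose_def
  by (simp, intro continuous_on_vec_lambda continuous_on_cnj continuous_on_component assms)

text \<open>Bounded since the columns of a unitary matrix are unit vectors.\<close>

lemma compact_unitary_group: "compact (unitary_group :: (complex ^ 'n ^ 'n) set)"
proof -
  have "closed (unitary_group :: (complex ^ 'n ^ 'n) set)"
    unfolding unitary_group_def by (intro closed_Collect_eq continuous_intros)
  moreover have "norm M \<le> CARD('n) * CARD('n)" if "M \<in> unitary_group" for M :: "complex ^ 'n ^ 'n"
  proof -
    have entry: "norm (M $ i $ j) \<le> 1" for i j
    proof -
      have "(\<Sum>i\<in>UNIV. cnj (M $ i $ j) * M $ i $ j) = (adj M ** M) $ j $ j"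
        by (simp add: matrix_matrix_mult_def transpose_def)
      also have "\<dots> = 1"
        using that by (simp add: unitary_group_def Finite_Cartesian_Product.mat_def)
      also have "(\<Sum>i\<in>UNIV. cnj (M $ i $ j) * M $ i $ j)
          = (\<Sum>i\<in>UNIV. complex_of_real ((norm (M $ i $ j))\<^sup>2))"
        by (intro sum.cong refl) (metis complex_norm_square mult.commute)
      finally have "(\<Sum>i\<in>UNIV. complex_of_real ((norm (M $ i $ j))\<^sup>2)) = 1" .
      then have "(\<Sum>i\<in>UNIV. (norm (M $ i $ j))\<^sup>2) = 1"
        by (metis of_real_eq_1_iff of_real_sum)
      then have "(norm (M $ i $ j))\<^sup>2 \<le> 1"
        using member_le_sum[of i UNIV "\<lambda>i. (norm (M $ i $ j))\<^sup>2"] by simp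
      then show ?thesis
        by (simp add: power_le_one_iff abs_square_le_1)
    qed
    have "norm M \<le> (\<Sum>i\<in>UNIV. norm (M $ i))"
      unfolding norm_vec_def by (rule L2_set_le_sum) simp
    also have "\<dots> \<le> (\<Sum>i\<in>(UNIV :: 'n set). \<Sum>j\<in>(UNIV :: 'n set). 1)"
    proof (rule sum_mono)
      fix i
      have "norm (M $ i) \<le> (\<Sum>j\<in>UNIV. norm (M $ i $ j))"
        unfolding norm_vec_def[of "M $ i"] by (rule L2_set_le_sum) simp
      also have "\<dots> \<le> (\<Sum>j\<in>(UNIV :: 'n set). 1)"
        by (intro sum_mono entry)
      finally show "norm (M $ i) \<le> (\<Sum>j\<in>(UNIV :: 'n set). 1)" .
    qed
    finally show ?thesis by simp
  qed
  ultimately show ?thesis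
    by (auto simp: compact_eq_bounded_closed bounded_iff)
qed

locale haar =
  fixes H :: "(complex ^ 'n ^ 'n) measure"
  assumes haar: "normalized_haar_measure H"
begin

lemma sets_H: "sets H = sets (restrict_space borel unitary_group)"
  and emeasure_H: "emeasure H (space H) = 1"
  and invariant: "U \<in> unitary_group \<Longrightarrow> A \<in> sets H \<Longrightarrow> emeasure H ((**) U ` A) = emeasure H A"
  using haar by (auto simp: normalized_haar_measure_def)

lemma space_H: "space H = unitary_group"
  using sets_eq_imp_space_eq[OF sets_H] by (simp add: space_restrict_space)

lemma finite_measure_H: "finite_measure H"
  by (rule finite_measureI) (simp add: emeasure_H)

lemma measurable_H: "continuous_on UNIV f \<Longrightarrow> f \<in> borel_measurable H"
  for f :: "complex ^ 'n ^ 'n \<Rightarrow> 'b::topological_space"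
  unfolding measurable_cong_sets[OF sets_H refl]
  by (intro measurable_restrict_space1 borel_measurable_continuous_onI)

lemma integrable_H:
  fixes f :: "complex ^ 'n ^ 'n \<Rightarrow> complex"
  assumes "continuous_on UNIV f"
  shows "integrable H f"
proof -
  have "compact (f ` unitary_group)"
    by (intro compact_continuous_image compact_unitary_group continuous_on_subset[OF assms]) simp
  then obtain C where "\<And>M. M \<in> unitary_group \<Longrightarrow> norm (f M) \<le> C"
    by (metis bounded_iff compact_imp_bounded imageI)
  then show ?thesis
    by (intro finite_measure.integrable_const_bound[OF finite_measure_H, of _ C] measurable_H assms)
       (auto simp: space_H)
qed

lemma integral_invariant:
  fixes f :: "complex ^ 'n ^ 'n \<Rightarrow> complex"
  assumes U: "U \<in> unitary_group" and f: "continuous_on UNIV f"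
  shows "(LINT M|H. f (U ** M)) = (LINT M|H. f M)"
proof -
  have cont: "continuous_on UNIV ((**) U :: complex ^ 'n ^ 'n \<Rightarrow> complex ^ 'n ^ 'n)"
    by (rule continuous_on_matrix_mult[OF continuous_on_const continuous_on_id])
  have meas: "(**) U \<in> measurable H H"
    unfolding measurable_cong_sets[OF refl sets_H]
    by (rule measurable_restrict_space2) (auto simp: space_H intro: unitary_mult U measurable_H cont)
  have "distr H H ((**) U) = H"
  proof (rule measure_eqI)
    fix A assume "A \<in> sets (distr H H ((**) U))"
    then have A: "A \<in> sets H" by simp
    then have sub: "A \<subseteq> unitary_group"
      using sets.sets_into_space[of A H] by (simp add: space_H)
    have "(**) U -` A \<inter> space H = (**) (adj U) ` A"
    proof safe
      fix M assume "U ** M \<in> A"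
      then show "M \<in> (**) (adj U) ` A"
        by (intro image_eqI[of _ _ "U ** M"]) (simp_all add: matrix_mul_assoc unitary_adj[OF U])
    next
      fix M assume "M \<in> A"
      then show "adj U ** M \<in> (**) U -` A"
        by (simp add: matrix_mul_assoc unitary_adj[OF U])
    next
      fix M assume "M \<in> A"
      then show "adj U ** M \<in> space H"
        using sub by (auto simp: space_H intro: unitary_mult unitary_adj[OF U])
    qed
    then show "emeasure (distr H H ((**) U)) A = emeasure H A"
      using A meas by (simp add: emeasure_distr invariant unitary_adj[OF U])
  qed simp
  then show ?thesis
    using integral_distr[OF meas measurable_H[OF f]] by simp
qed

end

text \<open>The one-parameter group exp(i t P) of a projection P, whose exponential series collapses.
  The generators i P span the Lie algebra of the unitary group.\<close>

lemma unitary_reflection: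
  assumes "adj P = P" "P ** P = P"
  shows "mat 1 + cscale (cis t - 1) P \<in> unitary_group"
proof -
  have adj: "adj (mat 1 + cscale (cis t - 1) P) = mat 1 + cscale (cis (- t) - 1) (adj P)"
    by (simp add: Finite_Cartesian_Product.vec_eq_iff transpose_def Finite_Cartesian_Product.mat_def cis_cnj)
  have lin: "(mat 1 + cscale a P) ** (mat 1 + cscale b P) = mat 1 + cscale (a + b + a * b) P" for a b
  proof -
    have "cscale a P ** cscale b P = cscale (a * b) (P ** P)"
      by (simp add: Finite_Cartesian_Product.vec_eq_iff matrix_matrix_mult_def sum_distrib_left mult_ac)
    then show ?thesis
      by (simp add: matrix_add_ldistrib matrix_add_distrib_right assms)
        (simp add: Finite_Cartesian_Product.vec_eq_iff algebra_simps)
  qed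
  have "(cis (- t) - 1) + (cis t - 1) + (cis (- t) - 1) * (cis t - 1) = 0"
    by (simp add: algebra_simps cis_mult)
  then show ?thesis
    unfolding unitary_group_def mem_Collect_eq adj assms(1) lin
    by (simp add: Finite_Cartesian_Product.vec_eq_iff)
qed

lemma has_derivative_cscale_curve:
  "((\<lambda>t. M + cscale (cis t - 1) Y) has_derivative (\<lambda>s. cscale (of_real s * (\<i> * cis t)) Y)) (at t)"
proof -
  have "linear (\<lambda>c. cscale c Y)"
    by (rule linearI) (auto simp: Finite_Cartesian_Product.vec_eq_iff algebra_simps)
  then have bl: "bounded_linear (\<lambda>c. cscale c Y)"
    by (simp add: linear_conv_bounded_linear)
  have "((\<lambda>t. cis t - 1) has_derivative (\<lambda>s. of_real s * (\<i> * cis t))) (at t)"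
    by (auto intro!: derivative_eq_intros simp: scaleR_conv_of_real mult_ac)
  from has_derivative_add[OF has_derivative_const bounded_linear.has_derivative[OF bl this]]
  show ?thesis by simp
qed

lemma holo_continuous_arg:
  assumes "holo F F'" "continuous_on UNIV Y"
  shows "continuous_on UNIV (\<lambda>M. F' M (Y M))"
  using continuous_on_compose2[OF holo_continuous'[OF assms(1)], of UNIV "\<lambda>M. (M, Y M)"]
    continuous_on_Pair[OF continuous_on_id assms(2)]
  by simp

context haar
begin

text \<open>The integral of F(gM) cnj(K(gM)) does not change when g runs through the reflections exp(i t
  P). Its derivative at t = 0 is computed by dominated convergence of the difference
  quotients. The minus sign comes from the conjugate of i.\<close>

lemma integral_by_parts_projection:
  assumes F: "holo F F'" and K: "holo K K'" and P: "adj P = P" "P ** P = P"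
  shows "(LINT M|H. F' M (P ** M) * cnj (K M) - F M * cnj (K' M (P ** M))) = 0"
proof -
  define g where "g t = mat 1 + cscale (cis t - 1) P" for t
  define h where "h M = F M * cnj (K M)" for M
  define h' where "h' N M t = F' N (P ** M) * (\<i> * cis t) * cnj (K N) + F N * cnj (K' N (P ** M) * (\<i> * cis t))"
    for N M t
  have g: "g t \<in> unitary_group" for t
    unfolding g_def using P by (rule unitary_reflection)
  have gM: "g t ** M = M + cscale (cis t - 1) (P ** M)" for t M
    by (simp add: g_def matrix_add_distrib_right)
      (simp add: Finite_Cartesian_Product.vec_eq_iff matrix_matrix_mult_def sum_distrib_left mult_ac)
  have hder: "((\<lambda>t. h (g t ** M)) has_derivative (\<lambda>s. of_real s * h' (g t ** M) M t)) (at t)" for M t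
  proof -
    have "((\<lambda>t. h (g t ** M)) has_derivative
        (\<lambda>s. F (g t ** M) * cnj (K' (g t ** M) (cscale (of_real s * (\<i> * cis t)) (P ** M)))
           + F' (g t ** M) (cscale (of_real s * (\<i> * cis t)) (P ** M)) * cnj (K (g t ** M)))) (at t)"
      unfolding h_def gM
      by (intro has_derivative_mult has_derivative_cnj
          has_derivative_compose[OF has_derivative_cscale_curve holo_has_derivative[OF F]]
          has_derivative_compose[OF has_derivative_cscale_curve holo_has_derivative[OF K]])
    then show ?thesis
      by (simp add: h'_def holo_cscale[OF F] holo_cscale[OF K] algebra_simps)
  qed
  have hcont: "continuous_on UNIV h"
    unfolding h_def by (intro continuous_intros holo_continuous[OF F] holo_continuous[OF K])
  obtain C where C: "\<And>N M t. N \<in> unitary_group \<Longrightarrow> M \<in> unitary_group \<Longrightarrow> norm (h' N M t) \<le> C"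
  proof -
    define \<Gamma> where "\<Gamma> p = norm (F' (fst p) (P ** snd p)) * norm (K (fst p)) + norm (F (fst p)) * norm (K' (fst p) (P ** snd p))"
      for p
    have pair: "continuous_on UNIV (\<lambda>p :: (complex ^ 'n ^ 'n) \<times> (complex ^ 'n ^ 'n). (fst p, P ** snd p))"
      by (intro continuous_on_Pair continuous_on_matrix_mult continuous_on_fst continuous_on_snd
          continuous_on_id continuous_on_const)
    have 1: "continuous_on UNIV (\<lambda>p. F' (fst p) (P ** snd p))" "continuous_on UNIV (\<lambda>p. K' (fst p) (P ** snd p))"
      using continuous_on_compose2[OF holo_continuous'[OF F] pair] continuous_on_compose2[OF holo_continuous'[OF K] pair]
      by simp_all
    have "continuous_on UNIV \<Gamma>"
      unfolding \<Gamma>_def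
      by (intro continuous_intros 1 holo_continuous_fst[OF F] holo_continuous_fst[OF K])
    then have "compact (\<Gamma> ` (unitary_group \<times> unitary_group))"
      by (intro compact_continuous_image compact_Times compact_unitary_group) (auto intro: continuous_on_subset)
    then obtain C where C: "norm (\<Gamma> p) \<le> C" if "p \<in> unitary_group \<times> unitary_group" for p
      by (metis bounded_iff compact_imp_bounded imageI)
    have le: "norm (h' N M t) \<le> \<Gamma> (N, M)" for N M t
      unfolding h'_def \<Gamma>_def by (rule order.trans[OF norm_triangle_ineq]) (simp add: norm_mult)
    have "norm (h' N M t) \<le> C" if "N \<in> unitary_group" "M \<in> unitary_group" for N M t
      using le[of N M t] C[of "(N, M)"] that by simp
    then show ?thesis by (rule that)
  qed
  \<comment> \<open>the difference quotients at \<open>t = 1/(k + 1)\<close>, each of which has integral zero by invariance\<close>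
  define s where "s k M = (h (g (inverse (real (Suc k))) ** M) - h M) * of_nat (Suc k)" for k M
  have lip: "norm (s k M) \<le> C" if "M \<in> unitary_group" for k M
  proof -
    let ?t = "inverse (real (Suc k))"
    have "norm (h (g ?t ** M) - h (g 0 ** M)) \<le> C * norm (?t - 0)"
    proof (rule differentiable_bound[OF convex_UNIV])
      show "((\<lambda>t. h (g t ** M)) has_derivative (\<lambda>s. of_real s * h' (g t ** M) M t)) (at t)" for t
        by (rule hder)
      show "onorm (\<lambda>s. of_real s * h' (g t ** M) M t) \<le> C" for t
      proof (rule onorm_le)
        fix x :: real
        have "norm (h' (g t ** M) M t) * norm x \<le> C * norm x"
          by (intro mult_right_mono C unitary_mult g that) simp
        then show "norm (of_real x * h' (g t ** M) M t) \<le> C * norm x"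
          by (simp add: norm_mult mult.commute)
      qed
    qed simp_all
    moreover have "g 0 ** M = M"
      by (simp add: gM Finite_Cartesian_Product.vec_eq_iff)
    ultimately have "norm (h (g ?t ** M) - h M) \<le> C * ?t"
      by simp
    then have "norm (h (g ?t ** M) - h M) * real (Suc k) \<le> C"
      by (simp add: field_simps del: of_nat_Suc)
    then show ?thesis
      by (simp add: s_def norm_mult del: of_nat_Suc)
  qed
  have lim: "(\<lambda>k. s k M) \<longlonglongrightarrow> h' M M 0" for M
  proof -
    have "g 0 ** M = M"
      by (simp add: gM Finite_Cartesian_Product.vec_eq_iff)
    then have "((\<lambda>t. norm (h (g t ** M) - h M - of_real t * h' M M 0) / norm t) \<longlongrightarrow> 0) (at 0)"
      using hder[of M 0] by (simp add: has_derivative_at)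
    moreover have "filterlim (\<lambda>k. inverse (real (Suc k))) (at 0) sequentially"
      using LIMSEQ_inverse_real_of_nat by (auto simp: filterlim_at)
    ultimately have "(\<lambda>k. norm (h (g (inverse (real (Suc k))) ** M) - h M
        - of_real (inverse (real (Suc k))) * h' M M 0) / norm (inverse (real (Suc k)))) \<longlonglongrightarrow> 0"
      by (rule filterlim_compose)
    moreover have "norm (h (g (inverse (real (Suc k))) ** M) - h M
        - of_real (inverse (real (Suc k))) * h' M M 0) / norm (inverse (real (Suc k)))
        = norm (s k M - h' M M 0)" for k
    proof -
      have "norm (h (g (inverse (real (Suc k))) ** M) - h M
        - of_real (inverse (real (Suc k))) * h' M M 0) / norm (inverse (real (Suc k)))
        = norm ((h (g (inverse (real (Suc k))) ** M) - h M
        - of_real (inverse (real (Suc k))) * h' M M 0) * of_nat (Suc k))"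
        unfolding norm_mult by (simp add: field_simps del: of_nat_Suc)
      also have "(h (g (inverse (real (Suc k))) ** M) - h M
        - of_real (inverse (real (Suc k))) * h' M M 0) * of_nat (Suc k) = s k M - h' M M 0"
        by (simp add: s_def field_simps del: of_nat_Suc)
      finally show ?thesis .
    qed
    ultimately have "(\<lambda>k. norm (s k M - h' M M 0)) \<longlonglongrightarrow> 0"
      by (simp only:)
    then show ?thesis
      by (rule LIM_zero_cancel[OF tendsto_norm_zero_cancel])
  qed
  have scont: "continuous_on UNIV (\<lambda>M. h (g t ** M))" for t
    by (rule continuous_on_compose2[OF hcont]) (auto intro!: continuous_intros)
  have int0: "integral\<^sup>L H (s k) = 0" for k
    unfolding s_def using integral_invariant[OF g hcont]
    by (simp add: integrable_H[OF scont] integrable_H[OF hcont])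
  have "(\<lambda>k. integral\<^sup>L H (s k)) \<longlonglongrightarrow> (LINT M|H. h' M M 0)"
  proof (rule integral_dominated_convergence[where w = "\<lambda>_. C"])
    show "(\<lambda>M. h' M M 0) \<in> borel_measurable H"
      unfolding h'_def
      by (intro measurable_H continuous_intros holo_continuous[OF F] holo_continuous[OF K]
          holo_continuous_arg[OF F] holo_continuous_arg[OF K])
    show "s k \<in> borel_measurable H" for k
      unfolding s_def by (intro measurable_H continuous_intros scont hcont)
    show "integrable H (\<lambda>_. C)"
      by (simp add: finite_measure.integrable_const[OF finite_measure_H])
  qed (auto simp: space_H lip lim)
  then have "(LINT M|H. h' M M 0) = 0"
    unfolding int0 by (simp add: tendsto_const_iff)
  moreover have "h' M M 0 = \<i> * (F' M (P ** M) * cnj (K M) - F M * cnj (K' M (P ** M)))" for M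
    by (simp add: h'_def algebra_simps)
  ultimately show ?thesis by simp
qed

end

section \<open>The vector field (z + M)(1 + zM)\<close>

text \<open>The rank one matrix v w*. For v = w it is a multiple of a projection, and polarization
  reaches all matrix units.\<close>

definition outer :: "('n \<Rightarrow> complex) \<Rightarrow> ('n \<Rightarrow> complex) \<Rightarrow> complex ^ 'n ^ 'n" where
  "outer v w = (\<chi> i j. v i * cnj (w j))"

abbreviation matrix_unit :: "'n \<Rightarrow> 'n \<Rightarrow> complex ^ 'n ^ 'n" where
  "matrix_unit j k \<equiv> outer (\<lambda>i. of_bool (i = j)) (\<lambda>i. of_bool (i = k))"

lemma adj_outer: "adj (outer v w) = outer w v"
  by (simp add: outer_def Finite_Cartesian_Product.vec_eq_iff transpose_def)

lemma matrix_unit_mult: "(matrix_unit j k ** M) $ a $ b = of_bool (a = j) * M $ k $ b"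
proof -
  have "(\<Sum>c\<in>UNIV. cnj (of_bool (c = k)) * M $ c $ b) = (\<Sum>c\<in>UNIV. if c = k then M $ k $ b else 0)"
    by (intro sum.cong) auto
  then have "(\<Sum>c\<in>UNIV. cnj (of_bool (c = k)) * M $ c $ b) = M $ k $ b"
    by simp
  moreover have "(matrix_unit j k ** M) $ a $ b
      = of_bool (a = j) * (\<Sum>c\<in>UNIV. cnj (of_bool (c = k)) * M $ c $ b)"
    unfolding outer_def matrix_matrix_mult_def sum_distrib_left
    by (simp only: vec_lambda_beta mult.assoc)
  ultimately show ?thesis by simp
qed

lemma matrix_unit_expansion:
  "(\<Sum>j\<in>UNIV. \<Sum>k\<in>UNIV. cscale (A $ j $ k) (matrix_unit j k ** M)) = A ** M"
proof -
  have "(\<Sum>j\<in>UNIV. \<Sum>k\<in>UNIV. A $ j $ k * (of_bool (a = j) * M $ k $ b)) = (\<Sum>k\<in>UNIV. A $ a $ k * M $ k $ b)" for a b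
  proof -
    have "(\<Sum>j\<in>UNIV. \<Sum>k\<in>UNIV. A $ j $ k * (of_bool (a = j) * M $ k $ b))
        = (\<Sum>j\<in>UNIV. if j = a then \<Sum>k\<in>UNIV. A $ a $ k * M $ k $ b else 0)"
      by (intro sum.cong refl) auto
    then show ?thesis by simp
  qed
  then show ?thesis
    by (simp add: Finite_Cartesian_Product.vec_eq_iff sum_component matrix_unit_mult)
      (simp add: matrix_matrix_mult_def)
qed

context haar
begin

context
  fixes F K :: "complex ^ 'n ^ 'n \<Rightarrow> complex" and F' K' :: "complex ^ 'n ^ 'n \<Rightarrow> complex ^ 'n ^ 'n \<Rightarrow> complex"
  assumes F: "holo F F'" and K: "holo K K'"
begin

text \<open>The expression that vanishes for projections, extended to arbitrary B as a complex linear
  form. The adjoint makes it linear in spite of the conjugation.\<close>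

definition ibp :: "complex ^ 'n ^ 'n \<Rightarrow> complex" where
  "ibp B = (LINT M|H. F' M (B ** M) * cnj (K M) - F M * cnj (K' M (adj B ** M)))"

lemma continuous_ibp: "continuous_on UNIV (\<lambda>M. F' M (B ** M) * cnj (K M) - F M * cnj (K' M (C ** M)))"
  by (intro continuous_intros holo_continuous[OF F] holo_continuous[OF K]
      holo_continuous_arg[OF F] holo_continuous_arg[OF K])

lemma ibp_add: "ibp (B + C) = ibp B + ibp C"
proof -
  have "adj (B + C) = adj B + adj C"
    by (simp add: Finite_Cartesian_Product.vec_eq_iff transpose_def)
  then have "ibp (B + C) = (LINT M|H. (F' M (B ** M) * cnj (K M) - F M * cnj (K' M (adj B ** M)))
      + (F' M (C ** M) * cnj (K M) - F M * cnj (K' M (adj C ** M))))"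
    unfolding ibp_def
    by (simp add: matrix_add_distrib_right holo_plus[OF F] holo_plus[OF K] algebra_simps)
  also have "\<dots> = ibp B + ibp C"
    unfolding ibp_def by (rule Bochner_Integration.integral_add) (rule integrable_H[OF continuous_ibp])+
  finally show ?thesis .
qed

lemma ibp_cscale: "ibp (cscale c B) = c * ibp B"
proof -
  have mult: "cscale s X ** M = cscale s (X ** M)" for s and X M :: "complex ^ 'n ^ 'n"
    by (simp add: Finite_Cartesian_Product.vec_eq_iff matrix_matrix_mult_def sum_distrib_left mult_ac)
  have "adj (cscale c B) = cscale (cnj c) (adj B)"
    by (simp add: Finite_Cartesian_Product.vec_eq_iff transpose_def)
  then have "ibp (cscale c B) = (LINT M|H. c * (F' M (B ** M) * cnj (K M) - F M * cnj (K' M (adj B ** M))))"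
    unfolding ibp_def by (simp only: mult holo_cscale[OF F] holo_cscale[OF K]) (simp add: algebra_simps)
  then show ?thesis
    by (simp add: ibp_def)
qed

lemma ibp_outer_self: "ibp (outer v v) = 0"
proof (cases "\<forall>i. v i = 0")
  case True
  then have "outer v v = cscale 0 0"
    by (simp add: outer_def Finite_Cartesian_Product.vec_eq_iff)
  then show ?thesis
    by (simp only: ibp_cscale) simp
next
  case False
  define c where "c = (\<Sum>i\<in>UNIV. cnj (v i) * v i)"
  have c': "c = of_real (\<Sum>i\<in>UNIV. (norm (v i))\<^sup>2)"
    unfolding c_def of_real_sum by (intro sum.cong refl) (metis complex_norm_square mult.commute)
  from False obtain i where "v i \<noteq> 0" by auto
  then have "(\<Sum>i\<in>UNIV. (norm (v i))\<^sup>2) \<noteq> 0"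
    by (subst sum_nonneg_eq_0_iff) auto
  then have c0: "c \<noteq> 0" "cnj c = c"
    by (simp_all add: c' del: of_real_sum)
  define P where "P = cscale (inverse c) (outer v v)"
  have outer: "outer v v = cscale c P"
    using c0 by (simp add: P_def Finite_Cartesian_Product.vec_eq_iff)
  have adjP: "adj P = P"
    using c0 by (simp add: P_def Finite_Cartesian_Product.vec_eq_iff transpose_def outer_def)
  have "P ** P = P"
  proof -
    have "(P ** P) $ a $ b = inverse c * inverse c * (v a * cnj (v b) * c)" for a b
      by (simp add: P_def outer_def matrix_matrix_mult_def c_def sum_distrib_left mult_ac)
    then show ?thesis
      using c0 by (simp add: Finite_Cartesian_Product.vec_eq_iff P_def outer_def)
  qed
  then have "ibp P = 0"
    unfolding ibp_def adjP using adjP by (intro integral_by_parts_projection F K)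
  then show ?thesis
    by (simp add: outer ibp_cscale)
qed

text \<open>The sesquilinear form (v, w) to ibp (v w*) vanishes on the diagonal, hence identically.\<close>

lemma ibp_outer: "ibp (outer v w) = 0"
proof -
  \<comment> \<open>evaluated at \<open>s = 1\<close> and \<open>s = \<i>\<close> below, which gives two independent equations\<close>
  have pol: "cnj s * ibp (outer v w) + s * ibp (outer w v) = 0" for s
  proof -
    have "outer (\<lambda>i. v i + s * w i) (\<lambda>i. v i + s * w i)
        = outer v v + (cscale (cnj s) (outer v w) + (cscale s (outer w v) + cscale (s * cnj s) (outer w w)))"
      by (simp add: outer_def Finite_Cartesian_Product.vec_eq_iff algebra_simps)
    from arg_cong[OF this, of ibp] show ?thesis
      by (simp add: ibp_add ibp_cscale ibp_outer_self)
  qed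
  show ?thesis
    using pol[of 1] pol[of \<i>] by (simp add: add_eq_0_iff2 algebra_simps)
qed

lemma ibp_unit:
  "(LINT M|H. F' M (matrix_unit j k ** M) * cnj (K M) - F M * cnj (K' M (matrix_unit k j ** M))) = 0"
  using ibp_outer[of "\<lambda>i. of_bool (i = j)" "\<lambda>i. of_bool (i = k)"] by (simp add: ibp_def adj_outer)

end

lemma ibp_self:
  assumes F: "holo F F'" and K: "holo K K'"
  shows "(LINT M|H. F' M M * cnj (K M) - F M * cnj (K' M M)) = 0"
proof -
  have E: "(\<Sum>j\<in>UNIV. matrix_unit j j ** M) = M" for M :: "complex ^ 'n ^ 'n"
  proof -
    have "(\<Sum>j\<in>UNIV. of_bool (a = j) * M $ j $ b) = (\<Sum>j\<in>UNIV. if j = a then M $ a $ b else 0)" for a b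
      by (intro sum.cong) auto
    then show ?thesis
      unfolding Finite_Cartesian_Product.vec_eq_iff sum_component matrix_unit_mult by simp
  qed
  have "F' M M * cnj (K M) - F M * cnj (K' M M)
      = (\<Sum>j\<in>UNIV. F' M (matrix_unit j j ** M) * cnj (K M) - F M * cnj (K' M (matrix_unit j j ** M)))" for M
    using holo_sum_arg[OF F, of M "\<lambda>j. matrix_unit j j ** M" UNIV]
      holo_sum_arg[OF K, of M "\<lambda>j. matrix_unit j j ** M" UNIV]
    by (simp add: E sum_subtractf sum_distrib_left sum_distrib_right)
  then have "(LINT M|H. F' M M * cnj (K M) - F M * cnj (K' M M))
      = (\<Sum>j\<in>UNIV. LINT M|H. F' M (matrix_unit j j ** M) * cnj (K M) - F M * cnj (K' M (matrix_unit j j ** M)))"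
    by (simp only:) (intro Bochner_Integration.integral_sum integrable_H continuous_ibp F K)
  then show ?thesis
    by (simp only: ibp_unit[OF F K] sum.neutral_const)
qed

text \<open>The field M to M^2 is the sum of M_jk E_jk M over the matrix units E_jk. Absorbing the
  coefficient M_jk into F, its derivative along E_jk M contributes the divergence n tr M,
  while on the conjugate factor the coefficients combine to M* M = 1.\<close>

lemma ibp_square:
  assumes F: "holo F F'" and K: "holo K K'"
  shows "(LINT M|H. (of_nat CARD('n) * trace M * F M + F' M (M ** M)) * cnj (K M)
    - F M * cnj (K' M (mat 1))) = 0"
proof -
  let ?G = "\<lambda>j k M. (F M * (matrix_unit j k ** M) $ j $ k + F' M (matrix_unit j k ** M) * M $ j $ k) * cnj (K M)
    - F M * M $ j $ k * cnj (K' M (matrix_unit k j ** M))"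
  have FM: "holo (\<lambda>M. F M * M $ j $ k) (\<lambda>M X. F M * X $ j $ k + F' M X * M $ j $ k)" for j k
    by (intro holo_mult F holo_entry)
  have sum: "(of_nat CARD('n) * trace M * F M + F' M (M ** M)) * cnj (K M) - F M * cnj (K' M (mat 1))
      = (\<Sum>j\<in>UNIV. \<Sum>k\<in>UNIV. ?G j k M)" if "M \<in> unitary_group" for M
  proof -
    have 1: "(\<Sum>j\<in>UNIV. \<Sum>k\<in>UNIV. (matrix_unit j k ** M) $ j $ k) = of_nat CARD('n) * trace M"
      by (simp add: matrix_unit_mult trace_def)
    have 2: "(\<Sum>j\<in>UNIV. \<Sum>k\<in>UNIV. F' M (matrix_unit j k ** M) * M $ j $ k) = F' M (M ** M)"
      using arg_cong[OF matrix_unit_expansion[of M M], of "F' M"]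
      by (simp add: holo_sum_arg[OF F] holo_cscale[OF F] mult.commute)
    have "(\<Sum>j\<in>UNIV. \<Sum>k\<in>UNIV. cnj (M $ j $ k) * K' M (matrix_unit k j ** M)) = K' M (adj M ** M)"
      using arg_cong[OF matrix_unit_expansion[of "adj M" M], of "K' M"]
      by (subst sum.swap) (simp add: holo_sum_arg[OF K] holo_cscale[OF K] transpose_def)
    then have "(\<Sum>j\<in>UNIV. \<Sum>k\<in>UNIV. M $ j $ k * cnj (K' M (matrix_unit k j ** M))) = cnj (K' M (mat 1))"
      unfolding unitary_adj(3)[OF that] by (metis (no_types, lifting) cnj_sum complex_cnj_cnj complex_cnj_mult sum.cong)
    note 3 = this
    have "(\<Sum>j\<in>UNIV. \<Sum>k\<in>UNIV. ?G j k M)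
      = (F M * (\<Sum>j\<in>UNIV. \<Sum>k\<in>UNIV. (matrix_unit j k ** M) $ j $ k)
          + (\<Sum>j\<in>UNIV. \<Sum>k\<in>UNIV. F' M (matrix_unit j k ** M) * M $ j $ k)) * cnj (K M)
        - F M * (\<Sum>j\<in>UNIV. \<Sum>k\<in>UNIV. M $ j $ k * cnj (K' M (matrix_unit k j ** M)))"
      by (simp only: sum_subtractf sum.distrib ring_distribs sum_distrib_left sum_distrib_right mult.assoc)
    then show ?thesis
      unfolding 1 2 3 by (simp add: mult_ac)
  qed
  have cont: "continuous_on UNIV (?G j k)" for j k
    using continuous_ibp[OF FM K] by simp
  have "(LINT M|H. (of_nat CARD('n) * trace M * F M + F' M (M ** M)) * cnj (K M) - F M * cnj (K' M (mat 1)))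
      = (LINT M|H. (\<Sum>j\<in>UNIV. \<Sum>k\<in>UNIV. ?G j k M))"
    by (intro Bochner_Integration.integral_cong refl sum) (simp add: space_H)
  also have "\<dots> = (\<Sum>j\<in>UNIV. \<Sum>k\<in>UNIV. LINT M|H. ?G j k M)"
    by (subst Bochner_Integration.integral_sum)
      (intro Bochner_Integration.integrable_sum integrable_H cont sum.cong refl Bochner_Integration.integral_sum)+
  also have "\<dots> = 0"
    using ibp_unit[OF FM K] by simp
  finally show ?thesis .
qed

text \<open>The conjugate of \<open>ibp_square\<close> with F and K exchanged.\<close>

lemma ibp_one:
  assumes F: "holo F F'" and K: "holo K K'"
  shows "(LINT M|H. F' M (mat 1) * cnj (K M)
    - F M * cnj (of_nat CARD('n) * trace M * K M + K' M (M ** M))) = 0"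
proof -
  have "(LINT M|H. F' M (mat 1) * cnj (K M) - F M * cnj (of_nat CARD('n) * trace M * K M + K' M (M ** M)))
    = (LINT M|H. - cnj ((of_nat CARD('n) * trace M * K M + K' M (M ** M)) * cnj (F M) - K M * cnj (F' M (mat 1))))"
    by (simp add: mult.commute)
  also have "\<dots> = - cnj (LINT M|H. (of_nat CARD('n) * trace M * K M + K' M (M ** M)) * cnj (F M) - K M * cnj (F' M (mat 1)))"
    by (simp only: Bochner_Integration.integral_minus Bochner_Integration.integral_cnj)
  finally show ?thesis
    by (simp only: ibp_square[OF K F]) simp
qed

text \<open>The vector field (z + M)(1 + zM). The factor 1 + zM cancels the denominator in the
  logarithmic derivative of det(1 + zM).\<close>

definition field_at :: "complex \<Rightarrow> complex ^ 'n ^ 'n \<Rightarrow> complex ^ 'n ^ 'n" where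
  "field_at z M = cscale z (mat 1) + (cscale (1 + z\<^sup>2) M + cscale z (M ** M))"

lemma holo_field_at:
  assumes "holo F F'"
  shows "F' M (field_at z M) = z * F' M (mat 1) + ((1 + z\<^sup>2) * F' M M + z * F' M (M ** M))"
  by (simp only: field_at_def holo_plus[OF assms] holo_cscale[OF assms])

text \<open>On the unitary group the field is (z/M + 1 + z^2 + zM) M, and inversion of M turns it into
  its negative with the same coefficients. This symmetry is why both factors are
  differentiated along the same field, up to conjugation of z.\<close>

lemma ibp_field:
  assumes F: "holo F F'" and K: "holo K K'"
  shows "(LINT M|H. (z * of_nat CARD('n) * trace M * F M + F' M (field_at z M)) * cnj (K M)
    - F M * cnj (cnj z * of_nat CARD('n) * trace M * K M + K' M (field_at (cnj z) M))) = 0"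
proof -
  let ?a = "\<lambda>M. (of_nat CARD('n) * trace M * F M + F' M (M ** M)) * cnj (K M) - F M * cnj (K' M (mat 1))"
  let ?b = "\<lambda>M. F' M (mat 1) * cnj (K M) - F M * cnj (of_nat CARD('n) * trace M * K M + K' M (M ** M))"
  let ?c = "\<lambda>M. F' M M * cnj (K M) - F M * cnj (K' M M)"
  have tr: "continuous_on UNIV (\<lambda>M :: complex ^ 'n ^ 'n. trace M)"
    unfolding trace_def by (intro continuous_intros)
  note cont = tr holo_continuous[OF F] holo_continuous[OF K] holo_continuous_arg[OF F] holo_continuous_arg[OF K]
  have int: "integrable H ?a" "integrable H ?b" "integrable H ?c"
    by (intro integrable_H continuous_intros cont)+
  have "(LINT M|H. (z * of_nat CARD('n) * trace M * F M + F' M (field_at z M)) * cnj (K M)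
    - F M * cnj (cnj z * of_nat CARD('n) * trace M * K M + K' M (field_at (cnj z) M)))
    = (LINT M|H. z * ?a M + (z * ?b M + (1 + z\<^sup>2) * ?c M))"
    by (rule Bochner_Integration.integral_cong)
      (simp_all add: holo_field_at[OF F] holo_field_at[OF K] algebra_simps)
  also have "\<dots> = z * integral\<^sup>L H ?a + (z * integral\<^sup>L H ?b + (1 + z\<^sup>2) * integral\<^sup>L H ?c)"
    by (subst Bochner_Integration.integral_add, (intro integrable_mult_right Bochner_Integration.integrable_add int)+)+
      (simp only: integral_mult_right_zero)
  finally show ?thesis
    by (simp only: ibp_square[OF F K] ibp_one[OF F K] ibp_self[OF F K] mult_zero_right add_0)
qed

end

section \<open>The difference equation for the integrals\<close>

lemma mpow_cnj: "mpow (map_matrix cnj M) k = map_matrix cnj (mpow M k)"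
  by (induction k)
    (simp_all add: Finite_Cartesian_Product.vec_eq_iff matrix_matrix_mult_def Finite_Cartesian_Product.mat_def)

lemma trace_cnj: "trace (map_matrix cnj M) = cnj (trace M)"
  by (simp add: trace_def)

lemma hom_series_cnj: "fps_nth (hom_series (map_matrix cnj M)) k = cnj (fps_nth (hom_series M) k)"
proof (induction k rule: less_induct)
  case (less k)
  show ?case
  proof (cases k)
    case (Suc m)
    have "fps_nth (hom_series (map_matrix cnj M)) (m - i) = cnj (fps_nth (hom_series M) (m - i))" for i
      using less.IH[of "m - i"] Suc by simp
    then show ?thesis
      unfolding Suc newton_identity mpow_cnj trace_cnj by (simp del: of_nat_Suc mpow.simps)
  qed (simp add: hom_series_0)
qed

lemma schur_mat_cnj: "schur_mat l (map_matrix cnj M) = cnj (schur_mat l M)"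
proof -
  have "hsym (map_matrix cnj M) k = cnj (hsym M k)" for k
    by (simp add: complete_homogeneous_eigenvalues hom_series_cnj)
  then show ?thesis
    by (simp add: schur_mat_eq fdet_eq)
qed

definition det1 :: "complex \<Rightarrow> complex ^ 'n ^ 'n \<Rightarrow> complex" where
  "det1 z M = det (mat 1 + cscale z M)"

lemma det1_cnj: "det1 z (map_matrix cnj M) = cnj (det1 (cnj z) M)"
proof -
  interpret comm_ring_hom cnj
    by unfold_locales auto
  have "mat 1 + cscale z (map_matrix cnj M) = map_matrix cnj (mat 1 + cscale (cnj z) M)"
    by (simp add: Finite_Cartesian_Product.vec_eq_iff Finite_Cartesian_Product.mat_def)
  then show ?thesis
    by (simp add: det1_def hom_det_vec)
qed

lemma holo_det1: "holo (det1 z) (\<lambda>M X. det_variation (mat 1 + cscale z M) (cscale z X))"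
proof -
  have "holo (\<lambda>M. (mat 1 :: complex ^ 'n ^ 'n) $ i $ j + z * M $ i $ j) (\<lambda>M X. 0 + z * X $ i $ j)" for i j
    by (intro holo_add holo_const holo_cmult holo_entry)
  then have "holo (\<lambda>M :: complex ^ 'n ^ 'n. det (mat 1 + cscale z M))
      (\<lambda>M X. det_variation (mat 1 + cscale z M) (cscale z X))"
    by (intro holo_det) simp
  then show ?thesis
    by (simp add: det1_def[abs_def])
qed

context haar
begin

text \<open>Here the direction is C (1 + zM) with C = z (z + M).\<close>

lemma det1_field:
  "det_variation (mat 1 + cscale z M) (cscale z (field_at z M))
    = z * (z * of_nat CARD('n) + trace M) * det1 z M"
proof -
  have left: "cscale c A ** B = cscale c (A ** B)" for c and A B :: "complex ^ 'n ^ 'n"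
    by (simp add: Finite_Cartesian_Product.vec_eq_iff matrix_matrix_mult_def sum_distrib_left mult_ac)
  define C where "C = cscale z (cscale z (mat 1) + M)"
  have "C ** (mat 1 + cscale z M) = cscale z (field_at z M)"
    unfolding C_def field_at_def left matrix_add_distrib_right matrix_add_ldistrib matrix_mul_cscale
      matrix_mul_lid matrix_mul_rid
    by (simp add: Finite_Cartesian_Product.vec_eq_iff algebra_simps power2_eq_square)
  then have "det_variation (mat 1 + cscale z M) (cscale z (field_at z M)) = trace C * det1 z M"
    by (metis det1_def det_variation_mult)
  also have "trace C = z * (z * of_nat CARD('n) + trace M)"
    by (simp only: C_def trace_cscale trace_add trace_I)
  finally show ?thesis .
qed

text \<open>The part of the difference equation that acts on l, multiplied by z. The summand n p z^2
  comes from the term z^2 of tr(z (z + M)) in the derivative of det(1 + zM)^p.\<close>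

definition diff_op :: "(nat \<Rightarrow> int) \<Rightarrow> nat \<Rightarrow> complex \<Rightarrow> ((nat \<Rightarrow> int) \<Rightarrow> complex) \<Rightarrow> complex" where
  "diff_op l p z f = z * (\<Sum>i=1..CARD('n). of_int (l i - int i + int CARD('n)) * f (l \<ominus>e i)
       + of_int (l i - int i + int CARD('n) + int p + 1) * f (l \<oplus>e i))
     + ((1 + z\<^sup>2) * of_int (\<Sum>i=1..CARD('n). l i) + of_int (int CARD('n) * int p) * z\<^sup>2) * f l"

text \<open>The terms with tr M are n from the divergence, -(n - 1) from the Schur function and p from
  the determinant. Together they are p + 1 times tr(M) s_l, which Pieri's rule expands into
  the s_(l + e_i).\<close>

lemma schur_field:
  assumes "is_partition CARD('n) l"
  shows "z * of_nat CARD('n) * trace M * (schur_mat l M * det1 z M ^ p)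
    + (schur_mat l M * (of_nat p * det_variation (mat 1 + cscale z M) (cscale z (field_at z M)) * det1 z M ^ (p - 1))
      + schur_deriv l M (field_at z M) * det1 z M ^ p)
    = diff_op l p z (\<lambda>k. schur_mat k M) * det1 z M ^ p"
proof -
  have pos: "l i - int i + int CARD('n) \<ge> 0" if "i \<in> {1..CARD('n)}" for i
  proof -
    have "0 \<le> l i"
      using assms that unfolding is_partition_def by blast
    with that show ?thesis by simp
  qed
  let ?W = "\<lambda>i. of_int (l i - int i + int CARD('n)) :: complex"
  have square: "schur_deriv l M (M ** M) = (\<Sum>i=1..CARD('n). ?W i * schur_mat (l \<oplus>e i) M)
      - of_int (int CARD('n) - 1) * trace M * schur_mat l M"
    by (rule schur_deriv_square) (rule pos)
  have pieri': "trace M * schur_mat l M = (\<Sum>i=1..CARD('n). schur_mat (l \<oplus>e i) M)"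
    by (rule pieri[symmetric]) (rule pos)
  define S1 where "S1 = (\<Sum>i=1..CARD('n). ?W i * schur_mat (l \<ominus>e i) M)"
  define S2 where "S2 = (\<Sum>i=1..CARD('n). ?W i * schur_mat (l \<oplus>e i) M)"
  have det: "schur_mat l M * (of_nat p * det_variation (mat 1 + cscale z M) (cscale z (field_at z M)) * det1 z M ^ (p - 1))
      = of_nat p * z * (z * of_nat CARD('n) + trace M) * schur_mat l M * det1 z M ^ p"
    unfolding det1_field by (cases p) (simp_all add: mult_ac)
  have D: "schur_deriv l M (field_at z M) = z * S1
      + ((1 + z\<^sup>2) * (of_int (\<Sum>i=1..CARD('n). l i) * schur_mat l M)
        + z * (S2 - of_int (int CARD('n) - 1) * trace M * schur_mat l M))"
    unfolding holo_field_at[OF holo_schur] schur_deriv_1 schur_deriv_self square S1_def S2_def ..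
  have S: "(\<Sum>i=1..CARD('n). ?W i * schur_mat (l \<ominus>e i) M
       + of_int (l i - int i + int CARD('n) + int p + 1) * schur_mat (l \<oplus>e i) M)
      = S1 + S2 + (of_nat p + 1) * (trace M * schur_mat l M)"
    unfolding S1_def S2_def pieri' sum_distrib_left sum.distrib[symmetric]
    by (intro sum.cong refl) (simp add: algebra_simps)
  show ?thesis
    unfolding det diff_op_def D S by (simp add: algebra_simps power2_eq_square)
qed

text \<open>The integral itself, without the convention that it is zero off partitions.\<close>

definition moment :: "nat \<Rightarrow> nat \<Rightarrow> complex \<Rightarrow> (nat \<Rightarrow> int) \<Rightarrow> (nat \<Rightarrow> int) \<Rightarrow> complex" where
  "moment p q z l m = (LINT M|H. schur_mat l M * cnj (schur_mat m M) * (det1 z M ^ p * cnj (det1 (cnj z) M ^ q)))"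

lemma a_coeff_moment:
  assumes "is_partition CARD('n) l" "is_partition CARD('n) m"
  shows "a_coeff H p q l m z = moment p q z l m"
proof -
  have "det (mat 1 + cscale z (map_matrix cnj M)) = cnj (det1 (cnj z) M)" for M :: "complex ^ 'n ^ 'n"
    by (simp only: det1_cnj flip: det1_def)
  then show ?thesis
    using assms by (simp add: a_coeff_def moment_def schur_mat_cnj mult.assoc flip: det1_def)
qed

text \<open>A form of integrability suited to pulling finite linear combinations such as
  \<open>diff_op\<close> out of the integral.\<close>

lemma moment_integral:
  "has_bochner_integral H (\<lambda>M. schur_mat l M * cnj (schur_mat m M) * (det1 z M ^ p * cnj (det1 (cnj z) M ^ q)))
     (moment p q z l m)"
  unfolding moment_def
  by (intro has_bochner_integral_integrable integrable_H continuous_intros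
      holo_continuous[OF holo_schur] holo_continuous[OF holo_det1])

lemma moment_difference_equation:
  assumes l: "is_partition CARD('n) l" and m: "is_partition CARD('n) m"
  shows "diff_op l p z (\<lambda>k. moment p q z k m) - diff_op m q z (\<lambda>k. moment p q z l k) = 0"
proof -
  let ?D = "\<lambda>M. det1 z M ^ p * cnj (det1 (cnj z) M ^ q)"
  let ?\<Phi> = "\<lambda>l m M. schur_mat l M * cnj (schur_mat m M) * ?D M"
  let ?F = "\<lambda>M. schur_mat l M * det1 z M ^ p" and ?K = "\<lambda>M. schur_mat m M * det1 (cnj z) M ^ q"
  let ?F' = "\<lambda>M X. schur_mat l M * (of_nat p * det_variation (mat 1 + cscale z M) (cscale z X) * det1 z M ^ (p - 1))
      + schur_deriv l M X * det1 z M ^ p"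
  let ?K' = "\<lambda>M X. schur_mat m M * (of_nat q * det_variation (mat 1 + cscale (cnj z) M) (cscale (cnj z) X) * det1 (cnj z) M ^ (q - 1))
      + schur_deriv m M X * det1 (cnj z) M ^ q"
  have F: "holo ?F ?F'" and K: "holo ?K ?K'"
    by (intro holo_mult holo_schur holo_power holo_det1)+
  have cnj_op: "cnj (diff_op m q (cnj z) (\<lambda>k. schur_mat k M)) = diff_op m q z (\<lambda>k. cnj (schur_mat k M))" for M
    by (simp add: diff_op_def)
  have "has_bochner_integral H (\<lambda>M. diff_op l p z (\<lambda>k. ?\<Phi> k m M) - diff_op m q z (\<lambda>k. ?\<Phi> l k M))
     (diff_op l p z (\<lambda>k. moment p q z k m) - diff_op m q z (\<lambda>k. moment p q z l k))"
    unfolding diff_op_def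
    by (intro has_bochner_integral_diff has_bochner_integral_add has_bochner_integral_sum
        has_bochner_integral_mult_right moment_integral)
  then have "diff_op l p z (\<lambda>k. moment p q z k m) - diff_op m q z (\<lambda>k. moment p q z l k)
     = (LINT M|H. diff_op l p z (\<lambda>k. ?\<Phi> k m M) - diff_op m q z (\<lambda>k. ?\<Phi> l k M))"
    by (simp add: has_bochner_integral_integral_eq)
  also have "\<dots> = (LINT M|H. (z * of_nat CARD('n) * trace M * ?F M + ?F' M (field_at z M)) * cnj (?K M)
    - ?F M * cnj (cnj z * of_nat CARD('n) * trace M * ?K M + ?K' M (field_at (cnj z) M)))"
  proof (rule Bochner_Integration.integral_cong[OF refl])
    fix M :: "complex ^ 'n ^ 'n"
    have op_mult: "diff_op l p z (\<lambda>k. f k * c) = diff_op l p z f * c" for l p f c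
      by (simp add: diff_op_def sum_distrib_left sum_distrib_right algebra_simps)
    have 1: "diff_op l p z (\<lambda>k. ?\<Phi> k m M) = diff_op l p z (\<lambda>k. schur_mat k M) * det1 z M ^ p * cnj (?K M)"
      using op_mult[of l p "\<lambda>k. schur_mat k M" "cnj (schur_mat m M) * ?D M"] by (simp add: mult_ac)
    have 2: "diff_op m q z (\<lambda>k. ?\<Phi> l k M) = ?F M * cnj (diff_op m q (cnj z) (\<lambda>k. schur_mat k M) * det1 (cnj z) M ^ q)"
      using op_mult[of m q "\<lambda>k. cnj (schur_mat k M)" "schur_mat l M * ?D M"]
      by (simp add: cnj_op mult_ac)
    show "diff_op l p z (\<lambda>k. ?\<Phi> k m M) - diff_op m q z (\<lambda>k. ?\<Phi> l k M)
      = (z * of_nat CARD('n) * trace M * ?F M + ?F' M (field_at z M)) * cnj (?K M)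
        - ?F M * cnj (cnj z * of_nat CARD('n) * trace M * ?K M + ?K' M (field_at (cnj z) M))"
      unfolding schur_field[OF l] schur_field[OF m] 1 2 ..
  qed
  also have "\<dots> = 0"
    by (rule ibp_field[OF F K])
  finally show ?thesis .
qed

lemma moment_add_unit_left:
  assumes "is_partition CARD('n) l" "is_partition CARD('n) m"
  shows "a_coeff H p q (l \<oplus>e i) m z = moment p q z (l \<oplus>e i) m"
proof (cases "is_partition CARD('n) (l \<oplus>e i)")
  case False
  then show ?thesis
    using schur_mat_add_unit_eq_0[OF assms(1) False] by (simp add: a_coeff_def moment_def)
qed (simp add: a_coeff_moment assms)

lemma moment_add_unit_right:
  assumes "is_partition CARD('n) l" "is_partition CARD('n) m"
  shows "a_coeff H p q l (m \<oplus>e i) z = moment p q z l (m \<oplus>e i)"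
proof (cases "is_partition CARD('n) (m \<oplus>e i)")
  case False
  then show ?thesis
    using schur_mat_add_unit_eq_0[OF assms(2) False] by (simp add: a_coeff_def moment_def)
qed (simp add: a_coeff_moment assms)

lemma moment_sub_unit_left:
  assumes "is_partition CARD('n) l" "is_partition CARD('n) m" "i \<in> {1..CARD('n)}"
  shows "of_int (l i - int i + int CARD('n)) * a_coeff H p q (l \<ominus>e i) m z
    = of_int (l i - int i + int CARD('n)) * moment p q z (l \<ominus>e i) m"
proof (cases "is_partition CARD('n) (l \<ominus>e i)")
  case False
  have "of_int (l i - int i + int CARD('n)) * moment p q z (l \<ominus>e i) m
      = (LINT M|H. of_int (l i - int i + int CARD('n)) * schur_mat (l \<ominus>e i) M
          * (cnj (schur_mat m M) * (det1 z M ^ p * cnj (det1 (cnj z) M ^ q))))"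
    unfolding moment_def by (simp only: mult.assoc flip: integral_mult_right_zero)
  then show ?thesis
    using False unfolding schur_mat_sub_unit_eq_0[OF assms(1) False assms(3)] by (simp add: a_coeff_def)
qed (simp add: a_coeff_moment assms)

lemma moment_sub_unit_right:
  assumes "is_partition CARD('n) l" "is_partition CARD('n) m" "i \<in> {1..CARD('n)}"
  shows "of_int (m i - int i + int CARD('n)) * a_coeff H p q l (m \<ominus>e i) z
    = of_int (m i - int i + int CARD('n)) * moment p q z l (m \<ominus>e i)"
proof (cases "is_partition CARD('n) (m \<ominus>e i)")
  case False
  have "of_int (m i - int i + int CARD('n)) * moment p q z l (m \<ominus>e i)
      = (LINT M|H. cnj (of_int (m i - int i + int CARD('n)) * schur_mat (m \<ominus>e i) M)
          * (schur_mat l M * (det1 z M ^ p * cnj (det1 (cnj z) M ^ q))))"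
    unfolding moment_def
    by (subst integral_mult_right_zero[symmetric]) (intro Bochner_Integration.integral_cong refl, simp add: mult_ac)
  then show ?thesis
    using False unfolding schur_mat_sub_unit_eq_0[OF assms(2) False assms(3)] by (simp add: a_coeff_def)
qed (simp add: a_coeff_moment assms)

lemma a_coeff_difference_equation:
  assumes l: "is_partition CARD('n) l" and m: "is_partition CARD('n) m"
  shows "diff_op l p z (\<lambda>k. a_coeff H p q k m z) - diff_op m q z (\<lambda>k. a_coeff H p q l k z) = 0"
proof -
  have "(\<Sum>i=1..CARD('n). of_int (l i - int i + int CARD('n)) * a_coeff H p q (l \<ominus>e i) m z
       + of_int (l i - int i + int CARD('n) + int p + 1) * moment p q z (l \<oplus>e i) m)
    = (\<Sum>i=1..CARD('n). of_int (l i - int i + int CARD('n)) * moment p q z (l \<ominus>e i) m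
       + of_int (l i - int i + int CARD('n) + int p + 1) * moment p q z (l \<oplus>e i) m)"
    by (rule sum.cong[OF refl]) (simp only: moment_sub_unit_left[OF l m])
  then have "diff_op l p z (\<lambda>k. a_coeff H p q k m z) = diff_op l p z (\<lambda>k. moment p q z k m)"
    unfolding diff_op_def a_coeff_moment[OF l m] moment_add_unit_left[OF l m] by (simp only:)
  moreover have "(\<Sum>i=1..CARD('n). of_int (m i - int i + int CARD('n)) * a_coeff H p q l (m \<ominus>e i) z
       + of_int (m i - int i + int CARD('n) + int q + 1) * moment p q z l (m \<oplus>e i))
    = (\<Sum>i=1..CARD('n). of_int (m i - int i + int CARD('n)) * moment p q z l (m \<ominus>e i)
       + of_int (m i - int i + int CARD('n) + int q + 1) * moment p q z l (m \<oplus>e i))"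
    by (rule sum.cong[OF refl]) (simp only: moment_sub_unit_right[OF l m])
  then have "diff_op m q z (\<lambda>k. a_coeff H p q l k z) = diff_op m q z (\<lambda>k. moment p q z l k)"
    unfolding diff_op_def a_coeff_moment[OF l m] moment_add_unit_right[OF l m] by (simp only:)
  ultimately show ?thesis
    using moment_difference_equation[OF l m] by simp
qed

end

section \<open>Expansion in powers of z\<close>

text \<open>Polynomials in z whose coefficients depend continuously on M, with a bound on the degree.
  They can be integrated coefficientwise.\<close>

definition contpoly :: "(complex ^ 'n ^ 'n \<Rightarrow> complex poly) \<Rightarrow> bool" where
  "contpoly Q \<longleftrightarrow> (\<forall>k. continuous_on UNIV (\<lambda>M. coeff (Q M) k)) \<and> (\<exists>N. \<forall>M. degree (Q M) \<le> N)"

lemma contpoly_const: "contpoly (\<lambda>_. c)"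
  by (auto simp: contpoly_def)

lemma contpoly_linear:
  assumes "continuous_on UNIV f" "continuous_on UNIV g"
  shows "contpoly (\<lambda>M. [:f M, g M:])"
proof -
  have "continuous_on UNIV (\<lambda>M. coeff [:f M, g M:] k)" for k
    by (cases k; cases "k - 1") (auto simp: coeff_pCons assms split: nat.split)
  moreover have "\<forall>M. degree [:f M, g M:] \<le> 1"
    by simp
  ultimately show ?thesis
    unfolding contpoly_def by blast
qed

lemma contpoly_mult:
  assumes "contpoly P" "contpoly Q"
  shows "contpoly (\<lambda>M. P M * Q M)"
proof -
  obtain N N' where "\<And>M. degree (P M) \<le> N" "\<And>M. degree (Q M) \<le> N'"
    using assms by (auto simp: contpoly_def)
  then have "degree (P M * Q M) \<le> N + N'" for M
    by (meson add_mono degree_mult_le order.trans)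
  moreover have "continuous_on UNIV (\<lambda>M. coeff (P M * Q M) k)" for k
    unfolding coeff_mult using assms by (intro continuous_intros) (auto simp: contpoly_def)
  ultimately show ?thesis
    unfolding contpoly_def by blast
qed

lemma contpoly_add:
  assumes "contpoly P" "contpoly Q"
  shows "contpoly (\<lambda>M. P M + Q M)"
proof -
  obtain N N' where "\<And>M. degree (P M) \<le> N" "\<And>M. degree (Q M) \<le> N'"
    using assms by (auto simp: contpoly_def)
  then have "degree (P M + Q M) \<le> max N N'" for M
    by (meson degree_add_le_max max.mono order.trans)
  moreover have "continuous_on UNIV (\<lambda>M. coeff (P M + Q M) k)" for k
    unfolding coeff_add using assms by (intro continuous_intros) (auto simp: contpoly_def)
  ultimately show ?thesis
    unfolding contpoly_def by blast
qed

lemma contpoly_sum: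
  assumes "finite S" "\<And>i. i \<in> S \<Longrightarrow> contpoly (P i)"
  shows "contpoly (\<lambda>M. \<Sum>i\<in>S. P i M)"
  using assms by (induction S) (auto intro: contpoly_const contpoly_add)

lemma contpoly_prod:
  assumes "finite S" "\<And>i. i \<in> S \<Longrightarrow> contpoly (P i)"
  shows "contpoly (\<lambda>M. \<Prod>i\<in>S. P i M)"
  using assms by (induction S) (auto intro: contpoly_const contpoly_mult)

lemma contpoly_power: "contpoly P \<Longrightarrow> contpoly (\<lambda>M. P M ^ k)"
  by (induction k) (auto intro: contpoly_const contpoly_mult)

definition det1_poly :: "complex ^ 'n ^ 'n \<Rightarrow> complex poly" where
  "det1_poly M = det (\<chi> i j. [:mat 1 $ i $ j, M $ i $ j:])"

lemma poly_det1_poly: "poly (det1_poly M) z = det1 z M"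
proof -
  interpret comm_ring_hom "\<lambda>p. poly p z" by (rule poly_eval_hom)
  have "map_matrix (\<lambda>p. poly p z) (\<chi> i j. [:mat 1 $ i $ j, M $ i $ j:]) = mat 1 + cscale z M"
    by (simp add: Finite_Cartesian_Product.vec_eq_iff)
  then show ?thesis
    by (simp add: det1_poly_def det1_def hom_det_vec)
qed

lemma contpoly_det1_poly:
  assumes "\<And>i j. continuous_on UNIV (\<lambda>M. B M $ i $ j)"
  shows "contpoly (\<lambda>M. det1_poly (B M))"
  unfolding det1_poly_def Determinants.det_def vec_lambda_beta
  by (intro contpoly_sum contpoly_mult contpoly_prod contpoly_const contpoly_linear
      continuous_on_const assms) auto

context haar
begin

lemma a_coeff_polynomial: "\<exists>A. \<forall>z. a_coeff H p q l m z = poly A z"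
proof (cases "is_partition CARD('n) l \<and> is_partition CARD('n) m")
  case True
  define Q where "Q M = [:schur_mat l M * cnj (schur_mat m M), 0:] * (det1_poly M ^ p * det1_poly (map_matrix cnj M) ^ q)"
    for M :: "complex ^ 'n ^ 'n"
  have "contpoly (\<lambda>M :: complex ^ 'n ^ 'n. det1_poly M)"
    by (rule contpoly_det1_poly) (rule holo_continuous[OF holo_entry])
  moreover have "contpoly (\<lambda>M :: complex ^ 'n ^ 'n. det1_poly (map_matrix cnj M))"
    by (rule contpoly_det1_poly) (simp, intro continuous_on_cnj holo_continuous[OF holo_entry])
  ultimately have Q: "contpoly Q"
    unfolding Q_def
    by (intro contpoly_mult contpoly_power contpoly_linear continuous_on_mult continuous_on_cnj
        continuous_on_const holo_continuous[OF holo_schur])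
  then obtain N where N: "\<And>M. degree (Q M) \<le> N"
    by (auto simp: contpoly_def)
  have cont: "continuous_on UNIV (\<lambda>M. coeff (Q M) k)" for k
    using Q by (simp add: contpoly_def)
  have "a_coeff H p q l m z = poly (\<Sum>k\<le>N. monom (LINT M|H. coeff (Q M) k) k) z" for z
  proof -
    have "poly (Q M) z = (\<Sum>k\<le>N. coeff (Q M) k * z ^ k)" for M
      unfolding poly_altdef by (rule sum.mono_neutral_left) (auto simp: N coeff_eq_0)
    moreover have "poly (Q M) z = schur_mat l M * cnj (schur_mat m M) * (det1 z M ^ p * cnj (det1 (cnj z) M ^ q))" for M
      by (simp add: Q_def poly_det1_poly det1_cnj)
    ultimately have "a_coeff H p q l m z = (LINT M|H. (\<Sum>k\<le>N. coeff (Q M) k * z ^ k))"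
      using True by (simp add: a_coeff_moment moment_def)
    also have "\<dots> = (\<Sum>k\<le>N. (LINT M|H. coeff (Q M) k) * z ^ k)"
      by (simp add: integrable_H[OF cont])
    finally show ?thesis
      by (simp add: poly_sum poly_monom)
  qed
  then show ?thesis by blast
next
  case False
  then show ?thesis
    by (intro exI[of _ 0]) (auto simp: a_coeff_def)
qed

definition a_poly :: "nat \<Rightarrow> nat \<Rightarrow> (nat \<Rightarrow> int) \<Rightarrow> (nat \<Rightarrow> int) \<Rightarrow> complex poly" where
  "a_poly p q l m = (SOME A. \<forall>z. a_coeff H p q l m z = poly A z)"

lemma poly_a_poly: "poly (a_poly p q l m) z = a_coeff H p q l m z"
proof -
  have "\<forall>z. a_coeff H p q l m z = poly (a_poly p q l m) z"
    unfolding a_poly_def by (rule someI_ex[OF a_coeff_polynomial])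
  then show ?thesis by (rule allE) (rule sym)
qed

lemma fps_expansion_a_coeff: "fps_expansion (a_coeff H p q l m) 0 = fps_of_poly (a_poly p q l m)"
proof (rule fps_expansion_eqI)
  have "eval_fps (fps_of_poly (a_poly p q l m)) has_fps_expansion fps_of_poly (a_poly p q l m)"
    by (rule eval_fps_has_fps_expansion) simp
  moreover have "eval_fps (fps_of_poly (a_poly p q l m)) = a_coeff H p q l m"
    by (simp add: fun_eq_iff poly_a_poly)
  ultimately show "a_coeff H p q l m has_fps_expansion fps_of_poly (a_poly p q l m)"
    by (simp only:)
qed

lemma a_poly_cong:
  assumes "\<And>i. i \<in> {1..CARD('n)} \<Longrightarrow> l i = l' i" "\<And>i. i \<in> {1..CARD('n)} \<Longrightarrow> m i = m' i"
  shows "a_poly p q l m = a_poly p q l' m'"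
proof -
  have part: "is_partition CARD('n) k = is_partition CARD('n) k'"
    if "\<And>i. i \<in> {1..CARD('n)} \<Longrightarrow> k i = k' i" for k k'
    using that by (auto simp: is_partition_def)
  have schur: "schur_mat k M = schur_mat k' M"
    if "\<And>i. i \<in> {1..CARD('n)} \<Longrightarrow> k i = k' i" for k k' and M :: "complex ^ 'n ^ 'n"
    unfolding schur_mat_eq using that by (intro arg_cong[of _ _ Determinant.det] cong_mat) auto
  have "is_partition CARD('n) l = is_partition CARD('n) l'" "is_partition CARD('n) m = is_partition CARD('n) m'"
    by (rule part, erule assms)+
  moreover have "schur_mat l M = schur_mat l' M" "schur_mat m M = schur_mat m' M" for M :: "complex ^ 'n ^ 'n"
    by (rule schur, erule assms)+
  ultimately have "a_coeff H p q l m z = a_coeff H p q l' m' z" for z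
    unfolding a_coeff_def by (simp only:)
  then show ?thesis
    by (simp add: poly_eq_poly_eq_iff[symmetric] poly_a_poly fun_eq_iff)
qed

text \<open>The two conventions agree: if x is not increasing then the shape of x is not a partition,
  and the integral is zero already.\<close>

lemma b_coeff_a_poly:
  "b_coeff H p q k x y
    = (if k < 0 then 0 else coeff (a_poly p q (shape CARD('n) x) (shape CARD('n) y)) (nat k))"
proof -
  have incr: "increasing CARD('n) x" if "is_partition CARD('n) (shape CARD('n) x)" for x
    unfolding increasing_def
  proof
    fix i assume i: "i \<in> {1..<CARD('n)}"
    have decr: "shape CARD('n) x (j + 1) \<le> shape CARD('n) x j" if "j \<in> {1..<CARD('n)}" for j
      using \<open>is_partition _ _\<close> that unfolding is_partition_def by blast
    have "CARD('n) - i \<in> {1..<CARD('n)}"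
      using i by auto
    from decr[OF this]
    have "shape CARD('n) x (CARD('n) - i + 1) \<le> shape CARD('n) x (CARD('n) - i)" .
    moreover have "CARD('n) - (CARD('n) - i + 1) + 1 = i" "CARD('n) - (CARD('n) - i + 1) = i - 1"
      "CARD('n) - (CARD('n) - i) = i" "int (i - 1) = int i - 1"
      using i by (auto simp: of_nat_diff)
    ultimately show "x i < x (i + 1)"
      unfolding shape_def by simp
  qed
  have zero: "a_poly p q l m = 0" if "\<not> (is_partition CARD('n) l \<and> is_partition CARD('n) m)" for l m
    using that by (simp only: poly_eq_poly_eq_iff[symmetric] poly_a_poly fun_eq_iff a_coeff_def) simp
  show ?thesis
  proof (cases "increasing CARD('n) x \<and> increasing CARD('n) y")
    case True
    then show ?thesis
      by (simp add: b_coeff_def fps_expansion_a_coeff)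
  next
    case False
    then have "a_poly p q (shape CARD('n) x) (shape CARD('n) y) = 0"
      using incr by (intro zero) blast
    with False show ?thesis
      by (auto simp: b_coeff_def)
  qed
qed

end

lemma shape_positions:
  assumes "i \<in> {1..n}"
  shows "shape n (positions n l) i = l i"
proof -
  have "n - (n - i + 1) + 1 = i" "int (n - i) = int n - int i" "int (n - i + 1) = int n - int i + 1"
    using assms by (auto simp: of_nat_diff)
  then show ?thesis
    unfolding shape_def positions_def by simp
qed

lemma shape_positions_sub_unit:
  assumes "i \<in> {1..n}" "j \<in> {1..n}"
  shows "shape n (positions n l \<ominus>e (n + 1 - j)) i = (l \<ominus>e j) i"
proof -
  have "n - i + 1 = n + 1 - j \<longleftrightarrow> i = j"
    using assms by auto
  then show ?thesis
    using shape_positions[OF assms(1), of l] by (auto simp: shape_def sub_unit_def)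
qed

lemma shape_positions_add_unit:
  assumes "i \<in> {1..n}" "j \<in> {1..n}"
  shows "shape n (positions n l \<oplus>e (n + 1 - j)) i = (l \<oplus>e j) i"
proof -
  have "n - i + 1 = n + 1 - j \<longleftrightarrow> i = j"
    using assms by auto
  then show ?thesis
    using shape_positions[OF assms(1), of l] by (auto simp: shape_def add_unit_def)
qed


lemma sum_reverse: "(\<Sum>i=1..n. f i) = (\<Sum>j=1..n. f (n + 1 - j))" for f :: "nat \<Rightarrow> 'a::comm_monoid_add"
  by (rule sum.reindex_bij_witness[of _ "\<lambda>j. n + 1 - j" "\<lambda>j. n + 1 - j"]) auto

lemma positions_reverse:
  assumes "j \<in> {1..n}"
  shows "positions n l (n + 1 - j) = l j - int j + int n"
proof -
  have "n - (n + 1 - j) + 1 = j" "int (n + 1 - j) = int n + 1 - int j"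
    using assms by (auto simp: of_nat_diff)
  then show ?thesis
    unfolding positions_def by simp
qed

lemma sum_positions: "(\<Sum>i=1..n. positions n l i) = (\<Sum>i=1..n. l i) + (\<Sum>i=1..n. int n - int i)"
  unfolding sum_reverse[of "positions n l"] sum.distrib[symmetric]
proof (rule sum.cong[OF refl])
  fix i assume "i \<in> {1..n}"
  from positions_reverse[OF this, of l]
  show "positions n l (n + 1 - i) = l i + (int n - int i)" by linarith
qed

context haar
begin

definition a_poly_coeff :: "nat \<Rightarrow> nat \<Rightarrow> int \<Rightarrow> (nat \<Rightarrow> int) \<Rightarrow> (nat \<Rightarrow> int) \<Rightarrow> complex" where
  "a_poly_coeff p q k l m = (if k < 0 then 0 else coeff (a_poly p q l m) (nat k))"

lemma b_coeff_cong:
  assumes "\<And>i. i \<in> {1..CARD('n)} \<Longrightarrow> shape CARD('n) x i = l i"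
    and "\<And>i. i \<in> {1..CARD('n)} \<Longrightarrow> shape CARD('n) y i = m i"
  shows "b_coeff H p q k x y = a_poly_coeff p q k l m"
proof -
  have "a_poly p q (shape CARD('n) x) (shape CARD('n) y) = a_poly p q l m"
    by (rule a_poly_cong) (fact assms)+
  then show ?thesis
    by (simp add: b_coeff_a_poly a_poly_coeff_def)
qed

lemma b_coeff_sub_unit:
  assumes "n = CARD('n)" "j \<in> {1..n}"
  shows "b_coeff H p q k (positions n l \<ominus>e (n + 1 - j)) (positions n m) = a_poly_coeff p q k (l \<ominus>e j) m"
    and "b_coeff H p q k (positions n l) (positions n m \<ominus>e (n + 1 - j)) = a_poly_coeff p q k l (m \<ominus>e j)"
proof -
  note j = assms(2)[unfolded assms(1)]
  show "b_coeff H p q k (positions n l \<ominus>e (n + 1 - j)) (positions n m) = a_poly_coeff p q k (l \<ominus>e j) m"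
    unfolding assms(1)
    by (rule b_coeff_cong, erule shape_positions_sub_unit, rule j, erule shape_positions)
  show "b_coeff H p q k (positions n l) (positions n m \<ominus>e (n + 1 - j)) = a_poly_coeff p q k l (m \<ominus>e j)"
    unfolding assms(1)
    by (rule b_coeff_cong, erule shape_positions, erule shape_positions_sub_unit, rule j)
qed

lemma b_coeff_add_unit:
  assumes "n = CARD('n)" "j \<in> {1..n}"
  shows "b_coeff H p q k (positions n l \<oplus>e (n + 1 - j)) (positions n m) = a_poly_coeff p q k (l \<oplus>e j) m"
    and "b_coeff H p q k (positions n l) (positions n m \<oplus>e (n + 1 - j)) = a_poly_coeff p q k l (m \<oplus>e j)"
proof -
  note j = assms(2)[unfolded assms(1)]
  show "b_coeff H p q k (positions n l \<oplus>e (n + 1 - j)) (positions n m) = a_poly_coeff p q k (l \<oplus>e j) m"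
    unfolding assms(1)
    by (rule b_coeff_cong, erule shape_positions_add_unit, rule j, erule shape_positions)
  show "b_coeff H p q k (positions n l) (positions n m \<oplus>e (n + 1 - j)) = a_poly_coeff p q k l (m \<oplus>e j)"
    unfolding assms(1)
    by (rule b_coeff_cong, erule shape_positions, erule shape_positions_add_unit, rule j)
qed

lemma a_coeff_difference_equation_expanded:
  assumes l: "is_partition CARD('n) l" and m: "is_partition CARD('n) m"
  shows "z * ((\<Sum>i=1..CARD('n). of_int (l i - int i + int CARD('n)) * a_coeff H p q (l \<ominus>e i) m z
             + of_int (l i - int i + int CARD('n) + int p + 1) * a_coeff H p q (l \<oplus>e i) m z)
    - (\<Sum>i=1..CARD('n). of_int (m i - int i + int CARD('n)) * a_coeff H p q l (m \<ominus>e i) z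
             + of_int (m i - int i + int CARD('n) + int q + 1) * a_coeff H p q l (m \<oplus>e i) z))
    + (1 + z\<^sup>2) * of_int ((\<Sum>i=1..CARD('n). l i) - (\<Sum>i=1..CARD('n). m i)) * a_coeff H p q l m z
    + of_int (int CARD('n) * (int p - int q)) * z\<^sup>2 * a_coeff H p q l m z = 0"
  (is "z * (?S - ?T) + _ * of_int (?l - ?m) * ?a + _ * _ * _ = 0")
proof -
  have "(z * ?S + ((1 + z\<^sup>2) * of_int ?l + of_int (int CARD('n) * int p) * z\<^sup>2) * ?a)
    - (z * ?T + ((1 + z\<^sup>2) * of_int ?m + of_int (int CARD('n) * int q) * z\<^sup>2) * ?a) = 0"
    using a_coeff_difference_equation[OF l m, of p z q] unfolding diff_op_def .
  moreover have "z * (S - T) + (1 + z\<^sup>2) * of_int (u - v) * a + of_int (c * (d - e)) * z\<^sup>2 * a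
    = (z * S + ((1 + z\<^sup>2) * of_int u + of_int (c * d) * z\<^sup>2) * a)
    - (z * T + ((1 + z\<^sup>2) * of_int v + of_int (c * e) * z\<^sup>2) * a)" for S T a :: complex and u v c d e :: int
    by (simp add: algebra_simps)
  ultimately show ?thesis by (simp only:)
qed

text \<open>Comparison of the coefficients of z^(k+1) in the polynomial identity. For k = -1 only the
  constant term of (1 + z^2)(|l| - |m|) a remains.\<close>

lemma a_poly_coeff_difference_equation:
  assumes l: "is_partition CARD('n) l" and m: "is_partition CARD('n) m"
  shows "(\<Sum>i=1..CARD('n). of_int (l i - int i + int CARD('n)) * a_poly_coeff p q k (l \<ominus>e i) m
             + of_int (l i - int i + int CARD('n) + int p + 1) * a_poly_coeff p q k (l \<oplus>e i) m)
    - (\<Sum>i=1..CARD('n). of_int (m i - int i + int CARD('n)) * a_poly_coeff p q k l (m \<ominus>e i)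
             + of_int (m i - int i + int CARD('n) + int q + 1) * a_poly_coeff p q k l (m \<oplus>e i))
    + of_int ((\<Sum>i=1..CARD('n). l i) - (\<Sum>i=1..CARD('n). m i))
        * (a_poly_coeff p q (k - 1) l m + a_poly_coeff p q (k + 1) l m)
    + of_int (int CARD('n) * (int p - int q)) * a_poly_coeff p q (k - 1) l m = 0"
    (is "?S k - ?T k + of_int ?c * _ + of_int ?d * _ = 0")
proof -
  define E where "E = (\<Sum>i=1..CARD('n). Polynomial.smult (of_int (l i - int i + int CARD('n))) (a_poly p q (l \<ominus>e i) m)
             + Polynomial.smult (of_int (l i - int i + int CARD('n) + int p + 1)) (a_poly p q (l \<oplus>e i) m))
    - (\<Sum>i=1..CARD('n). Polynomial.smult (of_int (m i - int i + int CARD('n))) (a_poly p q l (m \<ominus>e i))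
             + Polynomial.smult (of_int (m i - int i + int CARD('n) + int q + 1)) (a_poly p q l (m \<oplus>e i)))"
  define A where "A = a_poly p q l m"
  define R where "R = pCons 0 E + Polynomial.smult (of_int ?c) (A + pCons 0 (pCons 0 A))
    + Polynomial.smult (of_int ?d) (pCons 0 (pCons 0 A))"
  have "poly R z = 0" for z
  proof -
    have "poly R z = z * poly E z + (1 + z\<^sup>2) * of_int ?c * poly A z + of_int ?d * z\<^sup>2 * poly A z"
      by (simp add: R_def algebra_simps power2_eq_square)
    then show ?thesis
      using a_coeff_difference_equation_expanded[OF l m, of z p q]
      by (simp only: E_def A_def poly_diff poly_sum poly_add poly_smult poly_a_poly)
  qed
  then have "R = 0"
    using poly_all_0_iff_0 by blast
  then have R: "coeff R j = 0" for j
    by simp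
  have E: "?S k - ?T k = (if k < 0 then 0 else coeff E (nat k))"
    by (simp add: E_def a_poly_coeff_def coeff_sum)
  consider "k < -1" | "k = -1" | "k = 0" | "k > 0" by linarith
  then show ?thesis
  proof cases
    case 1
    then show ?thesis
      by (simp add: a_poly_coeff_def)
  next
    case 2
    then show ?thesis
      unfolding E using R[of 0] by (simp add: R_def A_def a_poly_coeff_def)
  next
    case 3
    then show ?thesis
      unfolding E using R[of 1] by (simp add: R_def A_def a_poly_coeff_def)
  next
    case 4
    then obtain j where "nat k = Suc j" by (metis Suc_pred zero_less_nat_eq)
    then have k: "nat k = Suc j" "nat (k - 1) = j" "nat (k + 1) = Suc (Suc j)"
      using 4 by auto
    have coeffs: "a_poly_coeff p q (k - 1) l m = coeff A j" "a_poly_coeff p q (k + 1) l m = coeff A (Suc (Suc j))"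
      "(if k < 0 then 0 else coeff E (nat k)) = coeff E (Suc j)"
      using 4 by (simp_all add: a_poly_coeff_def A_def k)
    show ?thesis
      unfolding E coeffs using R[of "Suc (Suc j)"]
      unfolding R_def coeff_add coeff_smult coeff_pCons_Suc by (simp only: add.commute)
  qed
qed

end

theorem mainTheorem9:
  fixes H :: "(complex ^ 'n ^ 'n) measure"
    and n p q :: nat
    and l m x y :: "nat \<Rightarrow> int"
    and a :: "(nat \<Rightarrow> int) \<Rightarrow> (nat \<Rightarrow> int) \<Rightarrow> complex \<Rightarrow> complex"
    and b :: "int \<Rightarrow> (nat \<Rightarrow> int) \<Rightarrow> (nat \<Rightarrow> int) \<Rightarrow> complex"
  defines "n \<equiv> CARD('n)"
    and "a \<equiv> a_coeff H p q"
    and "b \<equiv> b_coeff H p q"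
    and "x \<equiv> positions n l"
    and "y \<equiv> positions n m"
  assumes "normalized_haar_measure H"
    and "is_partition n l" and "is_partition n m"
  shows "(\<forall>z. (\<lambda>k. b (int k) x y * z ^ k) sums a l m z) \<and>
    (\<forall>z. z \<noteq> 0 \<longrightarrow>
      (\<Sum>i=1..n. of_int (l i - int i + int n) * a (l \<ominus>e i) m z
             + of_int (l i - int i + int n + int p + 1) * a (l \<oplus>e i) m z)
    - (\<Sum>i=1..n. of_int (m i - int i + int n) * a l (m \<ominus>e i) z
             + of_int (m i - int i + int n + int q + 1) * a l (m \<oplus>e i) z)
    + (z + inverse z) * of_int ((\<Sum>i=1..n. l i) - (\<Sum>i=1..n. m i)) * a l m z
    + of_int (int n * (int p - int q)) * z * a l m z = 0) \<and>
    (\<forall>k.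
      (\<Sum>i=1..n. of_int (x i) * b k (x \<ominus>e i) y
             + of_int (x i + int p + 1) * b k (x \<oplus>e i) y
             - of_int (y i) * b k x (y \<ominus>e i)
             - of_int (y i + int q + 1) * b k x (y \<oplus>e i))
    + (\<Sum>i=1..n. of_int (x i - y i) * (b (k - 1) x y + b (k + 1) x y))
    + of_int (int n * (int p - int q)) * b (k - 1) x y = 0)"
proof (intro conjI allI impI)
  interpret haar H by unfold_locales fact
  have l: "is_partition CARD('n) l" and m: "is_partition CARD('n) m"
    using \<open>is_partition n l\<close> \<open>is_partition n m\<close> by (simp_all add: n_def)
  have b: "b k x y = a_poly_coeff p q k l m" for k
    unfolding b_def x_def y_def n_def by (rule b_coeff_cong) (erule shape_positions)+

  show "(\<lambda>k. b (int k) x y * z ^ k) sums a l m z" for z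
  proof -
    have "(\<lambda>k. coeff (a_poly p q l m) k * z ^ k) sums (\<Sum>k\<le>degree (a_poly p q l m). coeff (a_poly p q l m) k * z ^ k)"
      by (rule sums_finite) (auto simp: coeff_eq_0)
    then show ?thesis
      by (simp add: b a_def a_poly_coeff_def flip: poly_a_poly poly_altdef)
  qed

  show "(\<Sum>i=1..n. of_int (l i - int i + int n) * a (l \<ominus>e i) m z
             + of_int (l i - int i + int n + int p + 1) * a (l \<oplus>e i) m z)
    - (\<Sum>i=1..n. of_int (m i - int i + int n) * a l (m \<ominus>e i) z
             + of_int (m i - int i + int n + int q + 1) * a l (m \<oplus>e i) z)
    + (z + inverse z) * of_int ((\<Sum>i=1..n. l i) - (\<Sum>i=1..n. m i)) * a l m z
    + of_int (int n * (int p - int q)) * z * a l m z = 0" (is "?S - ?T + _ * ?c * _ + ?d * _ * _ = 0")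
    if "z \<noteq> 0" for z
  proof -
    have "z * (?S - ?T + (z + inverse z) * ?c * a l m z + ?d * z * a l m z)
      = z * (?S - ?T) + (1 + z\<^sup>2) * ?c * a l m z + ?d * z\<^sup>2 * a l m z"
    proof -
      have "z * (r + (z + inverse z) * c * u + d * z * u) = z * r + (1 + z\<^sup>2) * c * u + d * z\<^sup>2 * u"
        for r c d u :: complex
        using that by (simp add: field_simps power2_eq_square)
      then show ?thesis .
    qed
    also have "\<dots> = 0"
      unfolding a_def n_def by (rule a_coeff_difference_equation_expanded[OF l m])
    finally show ?thesis
      using that by simp
  qed

  show "(\<Sum>i=1..n. of_int (x i) * b k (x \<ominus>e i) y
             + of_int (x i + int p + 1) * b k (x \<oplus>e i) y
             - of_int (y i) * b k x (y \<ominus>e i)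
             - of_int (y i + int q + 1) * b k x (y \<oplus>e i))
    + (\<Sum>i=1..n. of_int (x i - y i) * (b (k - 1) x y + b (k + 1) x y))
    + of_int (int n * (int p - int q)) * b (k - 1) x y = 0" for k
  proof -
    have units: "b k (x \<ominus>e (n + 1 - j)) y = a_poly_coeff p q k (l \<ominus>e j) m"
        "b k (x \<oplus>e (n + 1 - j)) y = a_poly_coeff p q k (l \<oplus>e j) m"
        "b k x (y \<ominus>e (n + 1 - j)) = a_poly_coeff p q k l (m \<ominus>e j)"
        "b k x (y \<oplus>e (n + 1 - j)) = a_poly_coeff p q k l (m \<oplus>e j)"
        "x (n + 1 - j) = l j - int j + int n" "y (n + 1 - j) = m j - int j + int n"
      if "j \<in> {1..n}" for j
      unfolding b_def x_def y_def
      by (rule b_coeff_add_unit b_coeff_sub_unit positions_reverse; use that n_def in simp)+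
    have "(\<Sum>i=1..n. of_int (x i) * b k (x \<ominus>e i) y
             + of_int (x i + int p + 1) * b k (x \<oplus>e i) y
             - of_int (y i) * b k x (y \<ominus>e i)
             - of_int (y i + int q + 1) * b k x (y \<oplus>e i))
      = (\<Sum>j=1..n. of_int (l j - int j + int n) * a_poly_coeff p q k (l \<ominus>e j) m
             + of_int (l j - int j + int n + int p + 1) * a_poly_coeff p q k (l \<oplus>e j) m
             - of_int (m j - int j + int n) * a_poly_coeff p q k l (m \<ominus>e j)
             - of_int (m j - int j + int n + int q + 1) * a_poly_coeff p q k l (m \<oplus>e j))"
      by (subst sum_reverse, rule sum.cong[OF refl]) (simp only: units)
    also have "\<dots> = (\<Sum>j=1..n. of_int (l j - int j + int n) * a_poly_coeff p q k (l \<ominus>e j) m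
             + of_int (l j - int j + int n + int p + 1) * a_poly_coeff p q k (l \<oplus>e j) m)
      - (\<Sum>j=1..n. of_int (m j - int j + int n) * a_poly_coeff p q k l (m \<ominus>e j)
             + of_int (m j - int j + int n + int q + 1) * a_poly_coeff p q k l (m \<oplus>e j))"
      unfolding sum_subtractf[symmetric] by (rule sum.cong[OF refl]) (simp only: diff_diff_eq)
    finally have sums: "(\<Sum>i=1..n. of_int (x i) * b k (x \<ominus>e i) y
             + of_int (x i + int p + 1) * b k (x \<oplus>e i) y
             - of_int (y i) * b k x (y \<ominus>e i)
             - of_int (y i + int q + 1) * b k x (y \<oplus>e i)) = \<dots>" .
    have "(\<Sum>i=1..n. x i - y i) = (\<Sum>i=1..n. l i) - (\<Sum>i=1..n. m i)"
      unfolding x_def y_def sum_subtractf sum_positions by simp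
    then have "(\<Sum>i=1..n. of_int (x i - y i) * (b (k - 1) x y + b (k + 1) x y))
      = of_int ((\<Sum>i=1..n. l i) - (\<Sum>i=1..n. m i))
        * (a_poly_coeff p q (k - 1) l m + a_poly_coeff p q (k + 1) l m)"
      unfolding sum_distrib_right[symmetric] of_int_sum[symmetric] b by (simp only:)
    then show ?thesis
      unfolding sums unfolding b n_def using a_poly_coeff_difference_equation[OF l m, of p q k] by (simp only:)
  qed
qed

end
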